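(* For every integer $t\ge 0$, the configuration $K_t$ on $16+2t$ rows and $4$ columns satisfies $(\mathrm{RW3}^{+})$. Consequently, $z_{\mathrm{RL}}(16+2t,4)=43+5t$ for every $t\ge 0$.
   Context: For a positive integer $r$ put $[r]=\{1,\dots,r\}$. Elements of the grid $[m]\times[n]$ are called cells; $(i,j)$ is in row $i$ and column $j$. A genuine rectangle is given by rows $i\ne k$ and columns $j\ne \ell$; it has the two diagonals $\{(i,j),(k,\ell)\}$ and $\{(i,\ell),(k,j)\}$. The classical Zarankiewicz number $z(m,n)$ is the maximum size of a set of cells of $[m]\times[n]$ containing no genuine rectangle with all four corners in the set (such a set, viewed as a bipartite graph, is called $C_4$-free). An augmented configuration $G=([m],[n],E_1\cup E_2)$ consists of a set $E_1$ of cells (one-edges) and a set $E_2$ of two-edges, a two-edge being an unordered pair of distinct cells (the two cells may share a row or a column). The support of a one-edge $(i,j)$ is $\{(i,j)\}$; the support of a two-edge $\{p,q\}$ is $\{p,q\}$. $G$ satisfies condition (S), i.e. is simple, if distinct selected edges (elements of $E_1\cup E_2$) have disjoint supports. Let $\Omega=E_1\cup\bigcup_{e\in E_2}e$ be the set of occupied cells; the other cells are holes; $N(G)=|E_1|+|E_2|$. For distinct cells $p,q$ put $\delta(p,q)=1$ if $\{p,q\}\in E_2$ and $\delta(p,q)=0$ otherwise. The strengthened closure of $G$ consists of the least equivalence relation $\sim$ on $\Omega$ and the least symmetric relation $\perp_R$ on $\Omega$ jointly closed under the following rules (only consequences of finitely many rule applications are certified): - Line rule: for distinct occupied cells $p,q$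 in the same row or the same column, if $\delta(p,q)=0$ add $p\perp_R q$; if $\delta(p,q)=1$ add $p\sim q$. - Saturation rule: if $p\sim p'$, $q\sim q'$ and $p'\perp_R q'$, add $p\perp_R q$. - Rectangle transfer: let a genuine rectangle have diagonals $\{p,q\}$ (target) and $\{r,s\}$ (companion). Suppose the companion is certified to have its prescribed value: if $\delta(r,s)=0$, this means at least one of $r,s$ is a hole or $r\perp_R s$; if $\delta(r,s)=1$, it means $r,s$ are both occupied and $r\sim s$. Then, if $p,q$ are occupied and $\delta(p,q)=0$, add $p\perp_R q$; if $\delta(p,q)=1$, add $p\sim q$. - Complementary-pair rule: if both diagonals $\{p,q\}$, $\{r,s\}$ of a genuine rectangle are in $E_2$, add $p\sim q$ and $r\sim s$. A simple configuration satisfies $(\mathrm{RW3}^{+})$ if in its strengthened closure: every two-edge $\{p,q\}\in E_2$ has $p\sim q$; distinct selected edges determine distinct $\sim$-classes; and for any two distinct selected edges $e,f$ there are $p\in\operatorname{supp}(e)$, $q\in\operatorname{supp}(f)$ with $p\perp_R q$. The recursive-line Zarankiewicz number $z_{\mathrm{RL}}(m,n)$ is the maximum of $N(G)$ over all augmented configurations $G$ on $[m]\times[n]$ such that $|E_1|=z(m,n)$, $G$ satisfies (S), $E_1$ is $C_4$-free, and $G$ satisfies $(\mathrm{RW3}^{+})$. The seed $K_0$ is the $16\times 4$ configuration given by the following matrix, where each $\bullet$ is a separate one-edge and each integer $j$ appears in exactly two cells, which form the two-edge $B_j$ ($1\le j\le 21$): $$\begin{array}{c|cccc}&1&2&3&4\\\hline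 1&\bullet&1&\bullet&1\\ 2&2&\bullet&\bullet&3\\ 3&4&5&\bullet&\bullet\\ 4&\bullet&\bullet&6&7\\ 5&\bullet&9&8&\bullet\\ 6&6&\bullet&10&\bullet\\ 7&12&\bullet&11&13\\ 8&7&\bullet&13&11\\ 9&15&16&14&\bullet\\ 10&17&14&16&\bullet\\ 11&18&10&15&\bullet\\ 12&19&17&19&\bullet\\ 13&3&8&12&\bullet\\ 14&21&21&20&\bullet\\ 15&5&20&18&\bullet\\ 16&9&4&2&\bullet\end{array}$$ For $t\ge1$, $K_t$ is the configuration on $16+2t$ rows and $4$ columns defined as follows. Rows $1,\dots,15$ are as in $K_0$, except that the label of cell $(2,1)$ is replaced by $A_0$ and the label of cell $(3,1)$ by $S_0$. With $u_i=14+2i$, $v_i=15+2i$ $(1\le i\le t)$ and $w=16+2t$, the remaining rows are (columns $1,2,3,4$ in order) $$u_i:\ (A_i,\,U_i,\,A_{i-1},\,R_i),\qquad v_i:\ (S_i,\,S_{i-1},\,V_i,\,R_i),\qquad w:\ (B_9,\,S_t,\,A_t,\,W).$$ Here $U_i,V_i,W$ are distinct one-edges; each of the labels $A_0,\dots,A_t$, $S_0,\dots,S_t$, $R_1,\dots,R_t$ occurs in exactly two cells, which form the two-edge of that name; the two-edges $B_j$ with $j\ne 2,4$ are retained (with $B_9=\{(5,2),(w,1)\}$), and $B_2,B_4$ are no longer present. *)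

theory Defs
  imports Main
begin

section \<open>Grids and the Zarankiewicz number\<close>

type_synonym cell = "nat \<times> nat"

definition grid :: "nat \<Rightarrow> nat \<Rightarrow> cell set" where
  "grid m n = {1..m} \<times> {1..n}"

definition C4_free :: "cell set \<Rightarrow> bool" where
  "C4_free E \<longleftrightarrow>
    \<not> (\<exists>i k j l. i \<noteq> k \<and> j \<noteq> l \<and>
        (i, j) \<in> E \<and> (i, l) \<in> E \<and> (k, j) \<in> E \<and> (k, l) \<in> E)"

definition zarankiewicz :: "nat \<Rightarrow> nat \<Rightarrow> nat" where
  "zarankiewicz m n = Max {card E | E. E \<subseteq> grid m n \<and> C4_free E}"


section \<open>Augmented configurations\<close>

record config =
  one_edges :: "cell set"
  two_edges :: "cell set set"

definition aug_config :: "nat \<Rightarrow> nat \<Rightarrow> config \<Rightarrow> bool" where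
  "aug_config m n G \<longleftrightarrow>
    one_edges G \<subseteq> grid m n \<and> (\<forall>e \<in> two_edges G. e \<subseteq> grid m n \<and> card e = 2)"

text \<open>A selected edge is identified with its support: a singleton for a one-edge,
  a two-element set for a two-edge.\<close>

definition edges :: "config \<Rightarrow> cell set set" where
  "edges G = (\<lambda>p. {p}) ` one_edges G \<union> two_edges G"

definition simple_config :: "config \<Rightarrow> bool" where
  "simple_config G \<longleftrightarrow> (\<forall>e \<in> edges G. \<forall>f \<in> edges G. e \<noteq> f \<longrightarrow> e \<inter> f = {})"

definition occupied :: "config \<Rightarrow> cell set" where
  "occupied G = one_edges G \<union> \<Union> (two_edges G)"

definition num_edges :: "config \<Rightarrow> nat" where
  "num_edges G = card (one_edges G) + card (two_edges G)"


section \<open>The strengthened closure\<close>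

text \<open>The prescribed value \<open>\<delta>(p,q) = 1\<close> is the condition \<open>{p, q} \<in> two_edges G\<close>.

  In the last three rules the target diagonal is \<open>{(i,j), (k,l)}\<close> and its companion is
  \<open>{(i,l), (k,j)}\<close>; exchanging \<open>j\<close> and \<open>l\<close> exchanges the two diagonals.  The target cells
  are occupied, so for an augmented configuration on a grid the whole rectangle lies in
  that grid, and a companion cell that is not occupied is a hole of the grid.\<close>

inductive rl_sim :: "config \<Rightarrow> cell \<Rightarrow> cell \<Rightarrow> bool"
  and rl_perp :: "config \<Rightarrow> cell \<Rightarrow> cell \<Rightarrow> bool"
  for G :: config
where
  sim_refl: "p \<in> occupied G \<Longrightarrow> rl_sim G p p"
| sim_sym: "rl_sim G p q \<Longrightarrow> rl_sim G q p"
| sim_trans: "rl_sim G p q \<Longrightarrow> rl_sim G q r \<Longrightarrow> rl_sim G p r"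
| perp_sym: "rl_perp G p q \<Longrightarrow> rl_perp G q p"
| line_perp:
    "p \<in> occupied G \<Longrightarrow> q \<in> occupied G \<Longrightarrow> p \<noteq> q \<Longrightarrow> fst p = fst q \<or> snd p = snd q \<Longrightarrow>
     {p, q} \<notin> two_edges G \<Longrightarrow> rl_perp G p q"
| line_sim:
    "p \<in> occupied G \<Longrightarrow> q \<in> occupied G \<Longrightarrow> p \<noteq> q \<Longrightarrow> fst p = fst q \<or> snd p = snd q \<Longrightarrow>
     {p, q} \<in> two_edges G \<Longrightarrow> rl_sim G p q"
| saturation:
    "rl_sim G p p' \<Longrightarrow> rl_sim G q q' \<Longrightarrow> rl_perp G p' q' \<Longrightarrow> rl_perp G p q"
| transfer_perp:
    "i \<noteq> k \<Longrightarrow> j \<noteq> l \<Longrightarrow>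
     {(i, l), (k, j)} \<notin> two_edges G \<and>
       ((i, l) \<notin> occupied G \<or> (k, j) \<notin> occupied G \<or> rl_perp G (i, l) (k, j)) \<or>
     {(i, l), (k, j)} \<in> two_edges G \<and>
       (i, l) \<in> occupied G \<and> (k, j) \<in> occupied G \<and> rl_sim G (i, l) (k, j) \<Longrightarrow>
     (i, j) \<in> occupied G \<Longrightarrow> (k, l) \<in> occupied G \<Longrightarrow>
     {(i, j), (k, l)} \<notin> two_edges G \<Longrightarrow> rl_perp G (i, j) (k, l)"
| transfer_sim:
    "i \<noteq> k \<Longrightarrow> j \<noteq> l \<Longrightarrow>
     {(i, l), (k, j)} \<notin> two_edges G \<and>
       ((i, l) \<notin> occupied G \<or> (k, j) \<notin> occupied G \<or> rl_perp G (i, l) (k, j)) \<or>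
     {(i, l), (k, j)} \<in> two_edges G \<and>
       (i, l) \<in> occupied G \<and> (k, j) \<in> occupied G \<and> rl_sim G (i, l) (k, j) \<Longrightarrow>
     {(i, j), (k, l)} \<in> two_edges G \<Longrightarrow> rl_sim G (i, j) (k, l)"
| complementary_pair:
    "i \<noteq> k \<Longrightarrow> j \<noteq> l \<Longrightarrow>
     {(i, j), (k, l)} \<in> two_edges G \<Longrightarrow> {(i, l), (k, j)} \<in> two_edges G \<Longrightarrow>
     rl_sim G (i, j) (k, l)"

definition sim_class :: "config \<Rightarrow> cell \<Rightarrow> cell set" where
  "sim_class G p = {q. rl_sim G p q}"

text \<open>By the first clause all cells of a selected edge lie in one class, the class
  determined by that edge.\<close>

definition RW3_plus :: "config \<Rightarrow> bool" where
  "RW3_plus G \<longleftrightarrow>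
    (\<forall>p q. {p, q} \<in> two_edges G \<longrightarrow> rl_sim G p q) \<and>
    (\<forall>e \<in> edges G. \<forall>f \<in> edges G. e \<noteq> f \<longrightarrow>
       (\<forall>p \<in> e. \<forall>q \<in> f. sim_class G p \<noteq> sim_class G q)) \<and>
    (\<forall>e \<in> edges G. \<forall>f \<in> edges G. e \<noteq> f \<longrightarrow> (\<exists>p \<in> e. \<exists>q \<in> f. rl_perp G p q))"

definition z_RL :: "nat \<Rightarrow> nat \<Rightarrow> nat" where
  "z_RL m n = Max {num_edges G | G.
     aug_config m n G \<and> card (one_edges G) = zarankiewicz m n \<and>
     simple_config G \<and> C4_free (one_edges G) \<and> RW3_plus G}"


section \<open>The configurations \<open>K\<^sub>t\<close>\<close>

datatype label =
    Dot | U nat | V nat | W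
  | A nat | B nat | S nat | R nat

fun one_label :: "label \<Rightarrow> bool" where
  "one_label Dot = True"
| "one_label (U i) = True"
| "one_label (V i) = True"
| "one_label W = True"
| "one_label (A i) = False"
| "one_label (B i) = False"
| "one_label (S i) = False"
| "one_label (R i) = False"

definition config_of_labels :: "nat \<Rightarrow> nat \<Rightarrow> (nat \<Rightarrow> nat \<Rightarrow> label) \<Rightarrow> config" where
  "config_of_labels m n L =
    \<lparr>one_edges = {(i, j) | i j. (i, j) \<in> grid m n \<and> one_label (L i j)},
     two_edges = {{(i, j), (k, l)} | i j k l.
       (i, j) \<in> grid m n \<and> (k, l) \<in> grid m n \<and> (i, j) \<noteq> (k, l) \<and>
       \<not> one_label (L i j) \<and> L i j = L k l}\<rparr>"

definition seed_matrix :: "label list list" where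
  "seed_matrix =
   [[Dot,  B 1,  Dot,  B 1 ],
    [B 2,  Dot,  Dot,  B 3 ],
    [B 4,  B 5,  Dot,  Dot ],
    [Dot,  Dot,  B 6,  B 7 ],
    [Dot,  B 9,  B 8,  Dot ],
    [B 6,  Dot,  B 10, Dot ],
    [B 12, Dot,  B 11, B 13],
    [B 7,  Dot,  B 13, B 11],
    [B 15, B 16, B 14, Dot ],
    [B 17, B 14, B 16, Dot ],
    [B 18, B 10, B 15, Dot ],
    [B 19, B 17, B 19, Dot ],
    [B 3,  B 8,  B 12, Dot ],
    [B 21, B 21, B 20, Dot ],
    [B 5,  B 20, B 18, Dot ],
    [B 9,  B 4,  B 2,  Dot ]]"

text \<open>Rows and columns are numbered from 1, list positions from 0.\<close>

definition seed_label :: "nat \<Rightarrow> nat \<Rightarrow> label" where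
  "seed_label i j = seed_matrix ! (i - 1) ! (j - 1)"

text \<open>In the last two cases \<open>r = 14 + 2 * s\<close> and \<open>r = 15 + 2 * s\<close>, respectively,
  with \<open>1 \<le> s \<le> t\<close>.\<close>

definition K_label :: "nat \<Rightarrow> nat \<Rightarrow> nat \<Rightarrow> label" where
  "K_label t r c =
    (if t = 0 then seed_label r c
     else if r \<le> 15 then
       (if (r, c) = (2, 1) then A 0
        else if (r, c) = (3, 1) then S 0
        else seed_label r c)
     else if r = 16 + 2 * t then [B 9, S t, A t, W] ! (c - 1)
     else if even r then
       (let s = (r - 14) div 2 in [A s, U s, A (s - 1), R s] ! (c - 1))
     else
       (let s = (r - 15) div 2 in [S s, S (s - 1), V s, R s] ! (c - 1)))"

definition K :: "nat \<Rightarrow> config" where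
  "K t = config_of_labels (16 + 2 * t) 4 (K_label t)"

end

theory Submission
  imports Defs
begin

text \<open>
  The value of \<open>z_RL\<close> comes from a count of cells.  In a \<open>C\<^sub>4\<close>-free set on four columns, different rows
  contain different pairs of columns, there are six pairs, and a row with \<open>d\<close> cells contains
  \<open>d choose 2 \<ge> d - 1\<close> of them; hence \<open>zarankiewicz m 4 \<le> m + 6\<close>, and the one-edges of \<open>K t\<close> attain this.
  Disjointness of supports bounds the number of one-edges plus twice the number of two-edges by the
  number of cells, and \<open>K t\<close> has no holes.  So \<open>K t\<close> is optimal as soon as it satisfies \<open>RW3_plus\<close>.

  Call a pair of cells settled if the closure certifies its prescribed value, that is \<open>\<sim>\<close> inside an
  edge and \<open>\<bottom>\<close> otherwise.  Since \<open>\<sim>\<close> never leaves an edge (\<open>rl_sim_within_edge\<close>), \<open>RW3_plus\<close> holds once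
  all pairs are settled.  For a configuration without holes the rules of the closure
  become moves on settled pairs: cells on a common line are settled, two cells may exchange their
  columns (\<open>settled_swap\<close>), and a cell may be replaced by the other cell of its two-edge
  once that two-edge is itself settled (\<open>settled_along_edge\<close>).

  Three groups of pairs remain.

  \<^item> The two cells of each two-edge.  They get settled one edge after the other: edges on a line and
    complementary pairs start, most of the \<open>B j\<close> follow, then \<open>S 0\<close>, ..., \<open>S t\<close> in this order, then \<open>B 9\<close> and
    \<open>B 8\<close>, which allow \<open>A t\<close>, ..., \<open>A 0\<close> in the opposite order, and at last \<open>B 3\<close>.

  \<^item> Two edges of the recursive tail.  Exchanging columns turns \<open>(A i, R j)\<close> into \<open>(R i, A j)\<close> and into
    \<open>(R (i + 1), A (j - 1))\<close>.  Both moves keep \<open>i + j\<close>, so one can walk to a pair of indices that meet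
    in a common row (\<open>zigzag\<close>).  The same works for \<open>(A i, U j)\<close> and \<open>(S i, V j)\<close>, and the other pairs of
    families are a few moves away from these or from pairs on a common line.

  \<^item> Pairs with a cell in rows 1 to 15.  Here the moves are independent of the position in the tail:
    it suffices to look at a window with the rows 1 to 15, the rows of one level \<open>i\<close> of the
    tail, and the last row, where a derivation is valid for all \<open>i\<close> at once.  Levels interact only through
    \<open>A i\<close> and \<open>S i\<close>, which occur on the levels \<open>i\<close> and \<open>i + 1\<close>.  This leaves a finite problem of
    reachability, which is solved by a depth-first search that is proved sound and evaluated.
\<close>

section \<open>Settled pairs\<close>

definition same_edge :: "config \<Rightarrow> cell \<Rightarrow> cell \<Rightarrow> bool" where
  "same_edge G p q \<longleftrightarrow> p = q \<or> {p, q} \<in> two_edges G"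

text \<open>The closure certifies the prescribed value of the pair.  Merging both relations into one makes
  the rules independent of the prescribed values.\<close>

definition settled :: "config \<Rightarrow> cell \<Rightarrow> cell \<Rightarrow> bool" where
  "settled G p q \<longleftrightarrow> (if same_edge G p q then rl_sim G p q else rl_perp G p q)"

lemma same_edge_refl [simp]: "same_edge G p p"
  by (simp add: same_edge_def)

lemma same_edge_sym: "same_edge G p q \<Longrightarrow> same_edge G q p"
  by (auto simp: same_edge_def insert_commute)

lemma same_edge_trans:
  assumes "simple_config G" "same_edge G p q" "same_edge G q r"
  shows "same_edge G p r"
proof (cases "p = q \<or> q = r")
  case True
  then show ?thesis using assms by auto
next
  case False
  then have "{p, q} \<in> edges G" "{q, r} \<in> edges G"
    using assms by (auto simp: same_edge_def edges_def)
  moreover have "{p, q} \<inter> {q, r} \<noteq> {}" by simp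
  ultimately have "{p, q} = {q, r}"
    using assms(1) unfolding simple_config_def by metis
  then show ?thesis by (auto simp: doubleton_eq_iff)
qed

lemma settled_sym: "settled G p q \<Longrightarrow> settled G q p"
  unfolding settled_def
  by (metis same_edge_sym sim_sym perp_sym)

lemma settled_line:
  assumes "p \<in> occupied G" "q \<in> occupied G" "fst p = fst q \<or> snd p = snd q"
  shows "settled G p q"
  using assms unfolding settled_def same_edge_def
  by (auto intro: sim_refl line_sim line_perp)

text \<open>The two transfer rules cover all four combinations of prescribed values, so a settled diagonal
  always settles the other one.  From here on this is read as a move: the two cells exchange their columns.\<close>

lemma settled_swap:
  assumes occ: "(i, j) \<in> occupied G" "(k, l) \<in> occupied G" "(i, l) \<in> occupied G" "(k, j) \<in> occupied G"
    and com: "settled G (i, l) (k, j)"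
  shows "settled G (i, j) (k, l)"
proof (cases "i = k \<or> j = l")
  case True
  then show ?thesis using occ by (intro settled_line) auto
next
  case False
  then have "{(i, l), (k, j)} \<notin> two_edges G \<and>
       ((i, l) \<notin> occupied G \<or> (k, j) \<notin> occupied G \<or> rl_perp G (i, l) (k, j)) \<or>
     {(i, l), (k, j)} \<in> two_edges G \<and>
       (i, l) \<in> occupied G \<and> (k, j) \<in> occupied G \<and> rl_sim G (i, l) (k, j)"
    using com occ by (auto simp: settled_def same_edge_def split: if_splits)
  with False show ?thesis
    using transfer_perp[of i k j l G] transfer_sim[of i k j l G] occ
    by (auto simp: settled_def same_edge_def)
qed

lemma settled_complementary_pair:
  assumes "i \<noteq> k" "j \<noteq> l" "{(i, j), (k, l)} \<in> two_edges G" "{(i, l), (k, j)} \<in> two_edges G"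
  shows "settled G (i, j) (k, l)"
  using complementary_pair[OF assms] assms by (simp add: settled_def same_edge_def)

text \<open>Saturation if \<open>q\<close> lies outside the edge of \<open>p\<close> and \<open>p'\<close>, transitivity of \<open>\<sim>\<close> if it lies inside.\<close>

lemma settled_along_edge:
  assumes "simple_config G" "q \<in> occupied G"
    and "same_edge G p p'" "settled G p p'" "settled G p' q"
  shows "settled G p q"
proof -
  have pp': "rl_sim G p p'" using assms by (simp add: settled_def)
  have "same_edge G p' q \<longleftrightarrow> same_edge G p q"
    using assms same_edge_trans same_edge_sym by meson
  then show ?thesis
    using assms(5) sim_trans[OF pp'] saturation[OF pp' sim_refl[OF assms(2)]]
    by (auto simp: settled_def)
qed

text \<open>Every rule that creates \<open>p \<sim> q\<close> for distinct cells asks for \<open>{p, q}\<close> to be a two-edge, and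
  two-edges are disjoint, so that transitivity adds nothing new.\<close>

lemma rl_sim_within_edge:
  assumes "simple_config G" and "rl_sim G p q"
  shows "same_edge G p q"
proof -
  have "(rl_sim G p q \<longrightarrow> same_edge G p q) \<and> (rl_perp G p q \<longrightarrow> True)"
  proof (induction rule: rl_sim_rl_perp.induct)
    case (sim_trans p q r)
    then show ?case using same_edge_trans[OF assms(1)] by blast
  qed (auto simp: same_edge_def insert_commute)
  then show ?thesis using assms(2) by blast
qed

lemma RW3_plus_if_settled:
  assumes aug: "aug_config m n G" and simple: "simple_config G"
    and all: "\<And>p q. p \<in> occupied G \<Longrightarrow> q \<in> occupied G \<Longrightarrow> settled G p q"
  shows "RW3_plus G"
proof -
  have occ: "p \<in> occupied G" if "p \<in> e" "e \<in> edges G" for p e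
    using that by (auto simp: edges_def occupied_def)
  have apart: "\<not> same_edge G p q" if "e \<in> edges G" "f \<in> edges G" "e \<noteq> f" "p \<in> e" "q \<in> f" for e f p q
  proof
    assume "same_edge G p q"
    then consider "p = q" | "{p, q} \<in> edges G" by (auto simp: same_edge_def edges_def)
    then show False
    proof cases
      case 1
      then show ?thesis using that simple unfolding simple_config_def by blast
    next
      case 2
      moreover have "p \<in> e \<inter> {p, q}" "q \<in> f \<inter> {p, q}" using that by auto
      ultimately show ?thesis using that simple unfolding simple_config_def by (metis empty_iff)
    qed
  qed
  have nonempty: "e \<noteq> {}" if "e \<in> edges G" for e
    using that aug by (auto simp: edges_def aug_config_def)
  show ?thesis
    unfolding RW3_plus_def
  proof (intro conjI allI ballI impI)
    fix p q assume pq: "{p, q} \<in> two_edges G"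
    then have "p \<in> occupied G" "q \<in> occupied G" by (auto simp: occupied_def)
    then show "rl_sim G p q" using all[of p q] pq by (simp add: settled_def same_edge_def)
  next
    fix e f p q
    assume H: "e \<in> edges G" "f \<in> edges G" "e \<noteq> f" "p \<in> e" "q \<in> f"
    have "q \<in> sim_class G q" using occ[OF H(5,2)] by (simp add: sim_class_def sim_refl)
    moreover have "q \<notin> sim_class G p"
      using apart[OF H] rl_sim_within_edge[OF simple, of p q] by (auto simp: sim_class_def)
    ultimately show "sim_class G p \<noteq> sim_class G q" by blast
  next
    fix e f assume H: "e \<in> edges G" "f \<in> edges G" "e \<noteq> f"
    then obtain p q where "p \<in> e" "q \<in> f" using nonempty by blast
    then show "\<exists>p\<in>e. \<exists>q\<in>f. rl_perp G p q"
      using apart[OF H] all[OF occ occ] H by (metis settled_def)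
  qed
qed

section \<open>Counting edges in four columns\<close>

lemma finite_grid [simp]: "finite (grid m n)" by (simp add: grid_def)
lemma card_grid: "card (grid m n) = m * n" by (simp add: grid_def)

text \<open>Disjoint supports turn the numbers of edges into a number of cells.\<close>

lemma simple_config_count:
  assumes aug: "aug_config m n G" and simple: "simple_config G"
  shows "card (one_edges G) + 2 * card (two_edges G) = card (occupied G)"
proof -
  have sub: "two_edges G \<subseteq> Pow (grid m n)" "one_edges G \<subseteq> grid m n"
    and two: "\<And>e. e \<in> two_edges G \<Longrightarrow> card e = 2"
    using aug by (auto simp: aug_config_def)
  have fin: "finite (two_edges G)" "finite (one_edges G)"
    using sub finite_subset by (auto intro: finite_subset)
  have "card (\<Union> (two_edges G)) = sum card (two_edges G)"
  proof (rule card_Union_disjoint)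
    show "pairwise disjnt (two_edges G)"
      using simple by (auto simp: pairwise_def disjnt_def simple_config_def edges_def)
    show "finite e" if "e \<in> two_edges G" for e using two[OF that] card.infinite by fastforce
  qed
  also have "\<dots> = 2 * card (two_edges G)" using two by simp
  finally have c: "card (\<Union> (two_edges G)) = 2 * card (two_edges G)" .
  have "one_edges G \<inter> \<Union> (two_edges G) = {}"
  proof (rule ccontr)
    assume "one_edges G \<inter> \<Union> (two_edges G) \<noteq> {}"
    then obtain p e where H: "p \<in> one_edges G" "e \<in> two_edges G" "p \<in> e" by blast
    then have "{p} \<in> edges G" "e \<in> edges G" "{p} \<noteq> e" using two[of e] by (auto simp: edges_def)
    then have "{p} \<inter> e = {}" using simple unfolding simple_config_def by metis
    then show False using H(3) by simp
  qed
  moreover have "finite (\<Union> (two_edges G))"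
    by (rule finite_subset[OF _ finite_grid[of m n]]) (use sub in blast)
  ultimately show ?thesis
    using c fin card_Un_disjoint[of "one_edges G" "\<Union> (two_edges G)"] by (simp add: occupied_def)
qed

lemma degree_bound: "d \<le> 1 + (d choose 2)"
proof (cases d)
  case (Suc e)
  then show ?thesis by (simp add: numeral_2_eq_2)
qed simp

text \<open>By \<open>degree_bound\<close> the number of cells exceeds the number of rows by at most the number of pairs
  of cells in a common row; these pairs lie over different pairs of columns, of which there are six.\<close>

lemma C4_free_four_columns:
  assumes E: "E \<subseteq> grid m 4" and C4: "C4_free E"
  shows "card E \<le> m + 6"
proof -
  define cols where "cols i = {j. (i, j) \<in> E}" for i
  define prs where "prs i = {J. J \<subseteq> cols i \<and> card J = 2}" for i
  have cols: "cols i \<subseteq> {1..4}" for i using E by (auto simp: cols_def grid_def)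
  then have fin: "finite (cols i)" for i using finite_subset by blast
  have "E = Sigma {1..m} cols" using E by (auto simp: cols_def grid_def)
  then have "card E = (\<Sum>i = 1..m. card (cols i))" using fin by simp
  also have "\<dots> \<le> (\<Sum>i = 1..m. 1 + (card (cols i) choose 2))"
    by (intro sum_mono degree_bound)
  also have "\<dots> = m + (\<Sum>i = 1..m. card (prs i))"
    unfolding sum.distrib by (simp add: prs_def n_subsets[OF fin])
  also have "(\<Sum>i = 1..m. card (prs i)) = card (\<Union>i\<in>{1..m}. prs i)"
  proof (rule card_UN_disjoint[symmetric])
    show "\<forall>i\<in>{1..m}. finite (prs i)" using fin by (simp add: prs_def)
    show "\<forall>i\<in>{1..m}. \<forall>k\<in>{1..m}. i \<noteq> k \<longrightarrow> prs i \<inter> prs k = {}"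
    proof (intro ballI impI equals0I)
      fix i k J assume "i \<noteq> k" "J \<in> prs i \<inter> prs k"
      then obtain j l where "j \<noteq> l" "{j, l} \<subseteq> cols i" "{j, l} \<subseteq> cols k"
        by (auto simp: prs_def card_2_iff)
      then have "(i, j) \<in> E \<and> (i, l) \<in> E \<and> (k, j) \<in> E \<and> (k, l) \<in> E"
        by (simp add: cols_def)
      then show False using \<open>i \<noteq> k\<close> \<open>j \<noteq> l\<close> C4 unfolding C4_free_def by metis
    qed
  qed simp
  also have "\<dots> \<le> card {J. J \<subseteq> {1..4::nat} \<and> card J = 2}"
    using cols by (intro card_mono) (auto simp: prs_def intro: finite_subset[of _ "Pow {1..4}"])
  also have "\<dots> = 6" using n_subsets[of "{1..4::nat}" 2] choose_two[of 4] by simp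
  finally show ?thesis by simp
qed

lemma zarankiewicz_four_columns:
  assumes "E \<subseteq> grid m 4" "C4_free E" "card E = m + 6"
  shows "zarankiewicz m 4 = m + 6"
  unfolding zarankiewicz_def
proof (rule Max_eqI)
  have "{card E | E. E \<subseteq> grid m 4 \<and> C4_free E} \<subseteq> {..m + 6}"
    using C4_free_four_columns by auto
  then show "finite {card E | E. E \<subseteq> grid m 4 \<and> C4_free E}" using finite_subset by blast
  have "card E \<in> {card E | E. E \<subseteq> grid m 4 \<and> C4_free E}" using assms(1,2) by blast
  then show "m + 6 \<in> {card E | E. E \<subseteq> grid m 4 \<and> C4_free E}" by (simp only: assms(3))
qed (use C4_free_four_columns in auto)

text \<open>All competitors have the same number of one-edges, hence a configuration without holes has the
  most two-edges.\<close>

lemma z_RL_eqI: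
  assumes G: "aug_config m n G" "simple_config G" "C4_free (one_edges G)" "RW3_plus G"
    and z: "card (one_edges G) = zarankiewicz m n"
    and full: "grid m n \<subseteq> occupied G"
  shows "z_RL m n = num_edges G"
proof -
  let ?S = "{num_edges G | G. aug_config m n G \<and> card (one_edges G) = zarankiewicz m n \<and>
     simple_config G \<and> C4_free (one_edges G) \<and> RW3_plus G}"
  have bound: "num_edges H \<le> num_edges G"
    if H: "aug_config m n H" "simple_config H" "card (one_edges H) = zarankiewicz m n" for H
  proof -
    have inside: "occupied F \<subseteq> grid m n" if "aug_config m n F" for F
      using that unfolding occupied_def aug_config_def by blast
    have "card (occupied H) \<le> card (occupied G)"
    proof (rule card_mono)
      show "finite (occupied G)" using inside[OF G(1)] finite_grid by (rule finite_subset)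
    qed (use inside[OF H(1)] full in blast)
    then show ?thesis
      using simple_config_count[OF H(1,2)] simple_config_count[OF G(1,2)] H(3) z
      by (simp add: num_edges_def)
  qed
  show ?thesis unfolding z_RL_def
  proof (rule Max_eqI)
    have "?S \<subseteq> {..num_edges G}" using bound by auto
    then show "finite ?S" using finite_subset by blast
  qed (use G z bound in auto)
qed

section \<open>A uniform labelling of the configurations\<close>

text \<open>Rows 1 to 15, as they are for \<open>t \<ge> 1\<close>.\<close>

definition base_rows :: "label list list" where
  "base_rows = (take 15 seed_matrix)[1 := [A 0, Dot, Dot, B 3], 2 := [S 0, B 5, Dot, Dot]]"

text \<open>For \<open>t = 0\<close> this differs from the seed by renaming \<open>B 2\<close>, \<open>B 4\<close> to \<open>A 0\<close>, \<open>S 0\<close> and the label of the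
  one-edge \<open>(16, 4)\<close> to \<open>W\<close>.  The configuration stays the same, and the seed becomes the member of the
  family with an empty tail.\<close>

definition label_at :: "nat \<Rightarrow> nat \<Rightarrow> nat \<Rightarrow> label" where
  "label_at t r c =
    (if r \<le> 15 then base_rows ! (r - 1) ! (c - 1)
     else if r = 16 + 2 * t then [B 9, S t, A t, W] ! (c - 1)
     else if even r then
       (let s = (r - 14) div 2 in [A s, U s, A (s - 1), R s] ! (c - 1))
     else
       (let s = (r - 15) div 2 in [S s, S (s - 1), V s, R s] ! (c - 1)))"

lemma grid_iff: "(r, c) \<in> grid m n \<longleftrightarrow> r \<in> {1..m} \<and> c \<in> {1..n}"
  by (simp add: grid_def)

lemma row_cases [consumes 1, case_names base u v w]:
  fixes r t :: nat
  assumes "r \<in> {1..16 + 2 * t}"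
  obtains "r \<in> {1..15}" | i where "i \<in> {1..t}" "r = 14 + 2 * i"
    | i where "i \<in> {1..t}" "r = 15 + 2 * i" | "r = 16 + 2 * t"
proof -
  consider "r \<le> 15" | "r = 16 + 2 * t" | "15 < r" "r < 16 + 2 * t" "even r" | "15 < r" "r < 16 + 2 * t" "odd r"
    using assms by fastforce
  then show thesis
  proof cases
    case 3
    then obtain k where "r = 2 * k" by (elim evenE)
    then show thesis using 3 by (intro that(2)[of "k - 7"]) auto
  next
    case 4
    then obtain k where "r = 2 * k + 1" by (elim oddE)
    then show thesis using 4 by (intro that(3)[of "k - 7"]) auto
  qed (use assms that in auto)
qed

lemma label_base: "r \<le> 15 \<Longrightarrow> label_at t r c = base_rows ! (r - 1) ! (c - 1)"
  by (simp add: label_at_def)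

lemma label_u:
  "i \<in> {1..t} \<Longrightarrow> label_at t (14 + 2 * i) c = [A i, U i, A (i - 1), R i] ! (c - 1)"
  by (auto simp: label_at_def Let_def)

lemma label_v:
  "i \<in> {1..t} \<Longrightarrow> label_at t (15 + 2 * i) c = [S i, S (i - 1), V i, R i] ! (c - 1)"
  by (auto simp: label_at_def Let_def)

lemma label_w: "label_at t (16 + 2 * t) c = [B 9, S t, A t, W] ! (c - 1)"
  by (simp add: label_at_def)

lemma four_columns: "c \<in> {1..4::nat} \<Longrightarrow> c = 1 \<or> c = 2 \<or> c = 3 \<or> c = 4"
  by auto

lemmas base_rows_eval = base_rows_def[unfolded seed_matrix_def, simplified]

definition base_cells :: "cell list" where
  "base_cells = List.product [1..<16] [1..<5]"

lemma set_base_cells: "set base_cells = grid 15 4"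
  by (auto simp: base_cells_def grid_def)

definition base_label :: "cell \<Rightarrow> label" where
  "base_label p = base_rows ! (fst p - 1) ! (snd p - 1)"

lemma label_at_base: "(r, c) \<in> grid 15 4 \<Longrightarrow> label_at t r c = base_label (r, c)"
  by (simp add: label_at_def base_label_def grid_def)

text \<open>The second cell of \<open>B 9\<close> lies in the last row, which is why \<open>B 9\<close> occurs only once here.\<close>

lemma base_classes:
  "list_all (\<lambda>p. case base_label p of
      Dot \<Rightarrow> True | A i \<Rightarrow> p = (2, 1) \<and> i = 0 | S i \<Rightarrow> p = (3, 1) \<and> i = 0
    | B j \<Rightarrow> (if j = 9 then filter (\<lambda>q. base_label q = B j) base_cells = [(5, 2)]
              else length (filter (\<lambda>q. base_label q = B j) base_cells) = 2)
    | _ \<Rightarrow> False) base_cells"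
  by code_simp

text \<open>Six rows contain two one-edges, one for each pair of columns.\<close>

lemma base_two_dots:
  "list_all (\<lambda>p. list_all (\<lambda>j. one_label (base_label p) \<longrightarrow> one_label (base_label (fst p, j)) \<longrightarrow> snd p < j \<longrightarrow>
      (fst p, snd p, j) \<in> {(1, 1, 3), (2, 2, 3), (3, 3, 4), (4, 1, 2), (5, 1, 4), (6, 2, 4)}) [1..<5]) base_cells"
  by code_simp

lemma base_dots: "length (filter (\<lambda>p. one_label (base_label p)) base_cells) = 21"
  by code_simp

lemma seed_modified:
  "list_all (\<lambda>p. (if p = (2, 1) then A 0 else if p = (3, 1) then S 0 else seed_label (fst p) (snd p)) = base_label p)
     base_cells"
  by code_simp

lemma seed_relabelled:
  "list_all (\<lambda>p. let l = seed_label (fst p) (snd p); l' = label_at 0 (fst p) (snd p) in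
      one_label l' = one_label l \<and>
      (\<not> one_label l \<longrightarrow> (\<exists>j. l = B j) \<and> l' = (if l = B 2 then A 0 else if l = B 4 then S 0 else l)))
     (List.product [1..<17] [1..<5])"
  by (simp add: base_rows_eval seed_matrix_def seed_label_def label_at_def upt_rec)

lemma config_of_labels_cong:
  assumes "\<And>i j. (i, j) \<in> grid m n \<Longrightarrow> one_label (L i j) = one_label (L' i j)"
    and "\<And>i j k l. (i, j) \<in> grid m n \<Longrightarrow> (k, l) \<in> grid m n \<Longrightarrow>
      \<not> one_label (L i j) \<Longrightarrow> \<not> one_label (L k l) \<Longrightarrow> (L i j = L k l) = (L' i j = L' k l)"
  shows "config_of_labels m n L = config_of_labels m n L'"
proof -
  have "(\<not> one_label (L i j) \<and> L i j = L k l) = (\<not> one_label (L' i j) \<and> L' i j = L' k l)"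
    if "(i, j) \<in> grid m n" "(k, l) \<in> grid m n" for i j k l
    using assms(1)[OF that(1)] assms(1)[OF that(2)] assms(2)[OF that] by metis
  then show ?thesis
    unfolding config_of_labels_def using assms(1) by (simp cong: conj_cong)
qed

text \<open>A configuration depends only on the one-edges and on which labels of two-edges agree, and the
  renaming for \<open>t = 0\<close> is injective on the latter.\<close>

lemma K_eq: "K t = config_of_labels (16 + 2 * t) 4 (label_at t)"
proof (cases "t = 0")
  case True
  have rel: "one_label (label_at 0 i j) = one_label (seed_label i j)"
    "\<not> one_label (seed_label i j) \<Longrightarrow> \<exists>k. seed_label i j = B k"
    "\<not> one_label (seed_label i j) \<Longrightarrow> label_at 0 i j =
       (if seed_label i j = B 2 then A 0 else if seed_label i j = B 4 then S 0 else seed_label i j)"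
    if "(i, j) \<in> grid 16 4" for i j
  proof -
    have "(i, j) \<in> set (List.product [1..<17] [1..<5])" using that by (auto simp: grid_def)
    from seed_relabelled[unfolded list_all_iff, THEN bspec, OF this]
    show "one_label (label_at 0 i j) = one_label (seed_label i j)"
      "\<not> one_label (seed_label i j) \<Longrightarrow> \<exists>k. seed_label i j = B k"
      "\<not> one_label (seed_label i j) \<Longrightarrow> label_at 0 i j =
       (if seed_label i j = B 2 then A 0 else if seed_label i j = B 4 then S 0 else seed_label i j)"
      by (simp_all add: Let_def)
  qed
  have "config_of_labels 16 4 seed_label = config_of_labels 16 4 (label_at 0)"
  proof (rule config_of_labels_cong)
    fix i j k l
    assume "(i, j) \<in> grid 16 4" "(k, l) \<in> grid 16 4"
      and "\<not> one_label (seed_label i j)" "\<not> one_label (seed_label k l)"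
    then show "(seed_label i j = seed_label k l) = (label_at 0 i j = label_at 0 k l)"
      using rel(2,3)[of i j] rel(2,3)[of k l] by (auto split: if_splits)
  qed (use rel(1) in simp)
  moreover have "K_label 0 = seed_label" by (simp add: K_label_def fun_eq_iff)
  ultimately show ?thesis using True by (simp add: K_def)
next
  case False
  have "(if (r, c) = (2, 1) then A 0 else if (r, c) = (3, 1) then S 0 else seed_label r c) = base_label (r, c)"
    if "(r, c) \<in> grid 15 4" for r c
    using seed_modified[unfolded list_all_iff set_base_cells, THEN bspec, OF that]
    by (auto split: if_splits)
  then have "K_label t r c = label_at t r c" if "(r, c) \<in> grid (16 + 2 * t) 4" for r c
    using that False by (auto simp: K_label_def label_at_def base_label_def grid_def)
  then show ?thesis unfolding K_def by (intro config_of_labels_cong) simp_all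
qed

abbreviation K_grid :: "nat \<Rightarrow> cell set" where "K_grid t \<equiv> grid (16 + 2 * t) 4"

definition lab :: "nat \<Rightarrow> cell \<Rightarrow> label" where "lab t p = label_at t (fst p) (snd p)"

text \<open>The two cells of a two-edge, for labels that occur in \<open>K t\<close>.  The first cells of \<open>A 0\<close> and \<open>S 0\<close> lie in the
  fixed rows.  For \<open>S t\<close> the last row takes the place of row \<open>17 + 2 * t\<close>, whereas for \<open>A t\<close> the general formula
  already gives the last row.\<close>

fun homes :: "nat \<Rightarrow> label \<Rightarrow> cell list" where
  "homes t (A i) = [(if i = 0 then 2 else 14 + 2 * i, 1), (16 + 2 * i, 3)]"
| "homes t (S i) = [(if i = 0 then 3 else 15 + 2 * i, 1), (if i = t then 16 + 2 * t else 17 + 2 * i, 2)]"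
| "homes t (R i) = [(14 + 2 * i, 4), (15 + 2 * i, 4)]"
| "homes t (B j) = filter (\<lambda>q. base_label q = B j) base_cells @ (if j = 9 then [(16 + 2 * t, 1)] else [])"
| "homes t l = []"

lemma base_cases:
  assumes "p \<in> grid 15 4"
  obtains "base_label p = Dot" | "base_label p = A 0" "p = (2, 1)" | "base_label p = S 0" "p = (3, 1)"
    | j where "base_label p = B j"
  using base_classes[unfolded list_all_iff set_base_cells, THEN bspec, OF assms]
  by (auto split: label.splits)

lemma lab_base: "p \<in> grid 15 4 \<Longrightarrow> lab t p = base_label p"
  by (cases p) (simp add: lab_def label_at_base)

lemma K_grid_cases [consumes 1, case_names base u v w]:
  assumes "p \<in> K_grid t"
  obtains "p \<in> grid 15 4"
    | i c where "i \<in> {1..t}" "c \<in> {1..4}" "p = (14 + 2 * i, c)" "lab t p = [A i, U i, A (i - 1), R i] ! (c - 1)"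
    | i c where "i \<in> {1..t}" "c \<in> {1..4}" "p = (15 + 2 * i, c)" "lab t p = [S i, S (i - 1), V i, R i] ! (c - 1)"
    | c where "c \<in> {1..4}" "p = (16 + 2 * t, c)" "lab t p = [B 9, S t, A t, W] ! (c - 1)"
proof -
  obtain r c where p: "p = (r, c)" by (cases p)
  have c: "c \<in> {1..4}" and "r \<in> {1..16 + 2 * t}" using assms by (auto simp: p grid_def)
  from this(2) show thesis
  proof (cases rule: row_cases)
    case base
    then show ?thesis using c by (intro that(1)) (simp add: p grid_def)
  next
    case (u i)
    then show ?thesis using c label_u[of i t c] by (intro that(2)[of i c]) (simp_all add: p lab_def)
  next
    case (v i)
    then show ?thesis using c label_v[of i t c] by (intro that(3)[of i c]) (simp_all add: p lab_def)
  next
    case w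
    then show ?thesis using c label_w[of t c] by (intro that(4)[of c]) (simp_all add: p lab_def)
  qed
qed

lemma in_homes:
  assumes "p \<in> K_grid t" "\<not> one_label (lab t p)"
  shows "p \<in> set (homes t (lab t p))"
  using assms(1)
proof (cases rule: K_grid_cases)
  case base
  from base show ?thesis
    by (cases rule: base_cases) (use base assms(2) in \<open>auto simp: lab_base set_base_cells\<close>)
next
  case (u i c)
  then show ?thesis using assms(2) four_columns[of c] by auto
next
  case (v i c)
  then show ?thesis using assms(2) four_columns[of c] by auto
next
  case (w c)
  then show ?thesis using assms(2) four_columns[of c] by auto
qed

lemma lab_A: "i \<le> t \<Longrightarrow> lab t (if i = 0 then 2 else 14 + 2 * i, 1) = A i" "i \<le> t \<Longrightarrow> lab t (16 + 2 * i, 3) = A i"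
  using label_u[of i t 1] label_u[of "Suc i" t 3] label_w[of t 3]
  by (cases "i = t"; auto simp: lab_def label_base base_rows_eval)+

lemma lab_S: "i \<le> t \<Longrightarrow> lab t (if i = 0 then 3 else 15 + 2 * i, 1) = S i"
  "i \<le> t \<Longrightarrow> lab t (if i = t then 16 + 2 * t else 17 + 2 * i, 2) = S i"
  using label_v[of i t 1] label_v[of "Suc i" t 2] label_w[of t 2]
  by (auto simp: lab_def label_base base_rows_eval)

lemma lab_R: "i \<in> {1..t} \<Longrightarrow> lab t (14 + 2 * i, 4) = R i" "i \<in> {1..t} \<Longrightarrow> lab t (15 + 2 * i, 4) = R i"
  using label_u[of i t 4] label_v[of i t 4] by (auto simp: lab_def)

lemma homes_twins:
  assumes "p \<in> K_grid t" "\<not> one_label (lab t p)"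
  obtains (twins) x y where "homes t (lab t p) = [x, y]" "x \<noteq> y" "x \<in> K_grid t" "y \<in> K_grid t"
    "lab t x = lab t p" "lab t y = lab t p"
proof -
  have A: thesis if "lab t p = A i" "i \<le> t" for i
    using that lab_A[of i t]
    by (intro twins[of "(if i = 0 then 2 else 14 + 2 * i, 1)" "(16 + 2 * i, 3)"]) (auto simp: grid_def)
  have S: thesis if "lab t p = S i" "i \<le> t" for i
    using that lab_S[of i t]
    by (intro twins[of "(if i = 0 then 3 else 15 + 2 * i, 1)" "(if i = t then 16 + 2 * t else 17 + 2 * i, 2)"])
      (auto simp: grid_def)
  have R: thesis if "lab t p = R i" "i \<in> {1..t}" for i
    using that lab_R[of i t] by (intro twins[of "(14 + 2 * i, 4)" "(15 + 2 * i, 4)"]) (auto simp: grid_def)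
  have nine: "filter (\<lambda>q. base_label q = B 9) base_cells = [(5, 2)]"
    using base_classes[unfolded list_all_iff set_base_cells, THEN bspec, of "(5, 2)"]
    by (simp add: grid_def base_label_def base_rows_eval)
  have B9: thesis if "lab t p = B 9"
    using that nine label_w[of t 1]
    by (intro twins[of "(5, 2)" "(16 + 2 * t, 1)"])
      (auto simp: grid_def lab_def base_rows_eval label_base)
  have B: thesis if p: "p \<in> grid 15 4" and j: "base_label p = B j" "j \<noteq> 9" for j
  proof -
    let ?ps = "filter (\<lambda>q. base_label q = B j) base_cells"
    have "length ?ps = 2"
      using base_classes[unfolded list_all_iff set_base_cells, THEN bspec, OF p] j by simp
    then obtain x y where xy: "?ps = [x, y]"
      by (metis (no_types, lifting) One_nat_def Suc_1 length_0_conv length_Suc_conv)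
    have "distinct ?ps" by (simp add: base_cells_def distinct_product)
    then have "x \<noteq> y" by (simp add: xy)
    moreover have "x \<in> set ?ps" "y \<in> set ?ps" by (simp_all add: xy)
    then have "x \<in> grid 15 4" "y \<in> grid 15 4" "base_label x = B j" "base_label y = B j"
      by (simp_all add: set_base_cells)
    ultimately show thesis
      using xy j p by (intro twins[of x y]) (auto simp: lab_base, auto simp: grid_def)
  qed
  from assms(1) show thesis
  proof (cases rule: K_grid_cases)
    case base
    from base show thesis
    proof (cases rule: base_cases)
      case (4 j)
      then show thesis using B[OF base] B9 base by (cases "j = 9") (simp_all add: lab_base)
    qed (use A[of 0] S[of 0] assms(2) base in \<open>simp_all add: lab_base\<close>)
  next
    case (u i c)
    then show thesis using assms(2) four_columns[of c] A[of i] A[of "i - 1"] R[of i] by fastforce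
  next
    case (v i c)
    then show thesis using assms(2) four_columns[of c] S[of i] S[of "i - 1"] R[of i] by fastforce
  next
    case (w c)
    then show thesis using assms(2) four_columns[of c] A[of t] S[of t] B9 by fastforce
  qed
qed

lemma two_edges_K:
  "{p, q} \<in> two_edges (K t) \<longleftrightarrow>
     p \<in> K_grid t \<and> q \<in> K_grid t \<and> p \<noteq> q \<and> \<not> one_label (lab t p) \<and> lab t p = lab t q"
proof -
  have "two_edges (K t) = {{p, q} | p q. p \<in> K_grid t \<and> q \<in> K_grid t \<and> p \<noteq> q \<and>
      \<not> one_label (lab t p) \<and> lab t p = lab t q}"
    unfolding K_eq config_of_labels_def lab_def by fastforce
  then have "{p, q} \<in> two_edges (K t) \<longleftrightarrow> (\<exists>x y. {p, q} = {x, y} \<and> x \<in> K_grid t \<and> y \<in> K_grid t \<and> x \<noteq> y \<and>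
      \<not> one_label (lab t x) \<and> lab t x = lab t y)" by blast
  then show ?thesis by (metis doubleton_eq_iff)
qed

lemma one_edges_K: "one_edges (K t) = {p \<in> K_grid t. one_label (lab t p)}"
  unfolding K_eq config_of_labels_def lab_def by auto

lemma two_edges_K_doubletons: "e \<in> two_edges (K t) \<Longrightarrow> \<exists>p q. e = {p, q}"
  unfolding K_eq config_of_labels_def by auto

lemma aug_config_K: "aug_config (16 + 2 * t) 4 (K t)"
  unfolding aug_config_def
proof (intro conjI ballI)
  fix e assume e: "e \<in> two_edges (K t)"
  then obtain p q where pq: "e = {p, q}" using two_edges_K_doubletons by blast
  with e show "e \<subseteq> K_grid t" "card e = 2" by (auto simp: two_edges_K)
qed (auto simp: one_edges_K)

lemma occupied_K: "occupied (K t) = K_grid t"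
proof
  show "occupied (K t) \<subseteq> K_grid t"
    using aug_config_K[of t] by (auto simp: occupied_def aug_config_def)
  show "K_grid t \<subseteq> occupied (K t)"
  proof
    fix p assume p: "p \<in> K_grid t"
    show "p \<in> occupied (K t)"
    proof (cases "one_label (lab t p)")
      case True
      then show ?thesis using p by (simp add: occupied_def one_edges_K)
    next
      case False
      obtain x y where xy: "x \<noteq> y" "x \<in> K_grid t" "y \<in> K_grid t" "lab t x = lab t p" "lab t y = lab t p"
        using homes_twins[OF p False] by metis
      then obtain q where "q \<in> K_grid t" "p \<noteq> q" "lab t p = lab t q" by metis
      then have "{p, q} \<in> two_edges (K t)" using p False by (simp add: two_edges_K)
      then show ?thesis by (auto simp: occupied_def)
    qed
  qed
qed

lemma same_label_at_most_two:
  assumes "p \<in> K_grid t" "q \<in> K_grid t" "r \<in> K_grid t" "\<not> one_label (lab t p)"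
    and "lab t q = lab t p" "lab t r = lab t p" "p \<noteq> q"
  shows "r = p \<or> r = q"
proof -
  obtain x y where "homes t (lab t p) = [x, y]" using homes_twins[OF assms(1,4)] by metis
  then have "p \<in> {x, y}" "q \<in> {x, y}" "r \<in> {x, y}"
    using in_homes[OF assms(1)] in_homes[OF assms(2)] in_homes[OF assms(3)] assms by auto
  then show ?thesis using assms(7) by auto
qed

lemma simple_K: "simple_config (K t)"
  unfolding simple_config_def
proof (intro ballI impI)
  fix e f assume ef: "e \<in> edges (K t)" "f \<in> edges (K t)" "e \<noteq> f"
  have edge: "e = {q \<in> K_grid t. q = p \<or> (\<not> one_label (lab t p) \<and> lab t q = lab t p)}"
    if "p \<in> e" "e \<in> edges (K t)" for p e
  proof (cases "e \<in> two_edges (K t)")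
    case False
    then have "p \<in> K_grid t" "one_label (lab t p)" "e = {p}"
      using that by (auto simp: edges_def one_edges_K)
    then show ?thesis by auto
  next
    case True
    then obtain q where e: "e = {p, q}"
      using two_edges_K_doubletons \<open>p \<in> e\<close> by (metis doubleton_eq_iff insertE singletonD)
    then have "p \<in> K_grid t" "q \<in> K_grid t" "p \<noteq> q" "\<not> one_label (lab t p)" "lab t q = lab t p"
      using True by (auto simp: two_edges_K)
    then show ?thesis using same_label_at_most_two[of p t q] e by auto
  qed
  show "e \<inter> f = {}"
  proof (rule equals0I)
    fix p assume "p \<in> e \<inter> f"
    then show False using edge[of p e] edge[of p f] ef by blast
  qed
qed

lemma same_edge_K:
  "p \<in> K_grid t \<Longrightarrow> q \<in> K_grid t \<Longrightarrow> \<not> one_label (lab t p) \<Longrightarrow> lab t p = lab t q \<Longrightarrow> same_edge (K t) p q"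
  by (auto simp: same_edge_def two_edges_K)

lemma card_one_edges_K:
  "card (one_edges (K t)) = 22 + 2 * t"
proof -
  let ?X = "(\<lambda>i. (14 + 2 * i, 2)) ` {1..t} \<union> (\<lambda>i. (15 + 2 * i, 3)) ` {1..t} \<union> {(16 + 2 * t, 4)} :: cell set"
  let ?D = "{p \<in> grid 15 4. one_label (base_label p)}"
  have "one_edges (K t) = ?D \<union> ?X" (is "?L = ?R")
  proof
    show "?L \<subseteq> ?R"
    proof
      fix p assume "p \<in> ?L"
      then have p: "p \<in> K_grid t" "one_label (lab t p)" by (simp_all add: one_edges_K)
      from p(1) show "p \<in> ?R"
      proof (cases rule: K_grid_cases)
        case base
        then show ?thesis using p(2) by (simp add: lab_base)
      next
        case (u i c)
        then show ?thesis using p(2) four_columns[of c] by auto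
      next
        case (v i c)
        then show ?thesis using p(2) four_columns[of c] by auto
      next
        case (w c)
        then show ?thesis using p(2) four_columns[of c] by auto
      qed
    qed
    have "lab t p = base_label p \<and> p \<in> K_grid t" if "p \<in> grid 15 4" for p
      using that lab_base[OF that] by (auto simp: grid_def)
    then show "?R \<subseteq> ?L"
      using label_u[of _ t 2] label_v[of _ t 3] label_w[of t 4]
      by (auto simp: one_edges_K lab_def grid_iff)
  qed
  moreover have "card ?X = 2 * t + 1"
  proof -
    let ?U = "(\<lambda>i. (14 + 2 * i, 2)) ` {1..t} :: cell set"
    let ?V = "(\<lambda>i. (15 + 2 * i, 3)) ` {1..t} :: cell set"
    have "card ?U = t" "card ?V = t" by (simp_all add: card_image inj_on_def)
    moreover have "card (?U \<union> ?V) = card ?U + card ?V"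
      by (rule card_Un_disjoint) auto
    moreover have "(16 + 2 * t, 4) \<notin> ?U \<union> ?V" by auto
    ultimately show ?thesis by simp
  qed
  moreover have "card ?D = 21"
  proof -
    have "?D = set (filter (\<lambda>p. one_label (base_label p)) base_cells)" by (auto simp: set_base_cells)
    moreover have "distinct base_cells" by (simp add: base_cells_def distinct_product)
    ultimately show ?thesis using base_dots by (simp add: distinct_card del: set_filter)
  qed
  moreover have "?D \<inter> ?X = {}" by (auto simp: grid_def)
  moreover have "finite ?D" using finite_grid[of 15 4] by simp
  ultimately show ?thesis using card_Un_disjoint[of ?D ?X] by simp
qed

lemma C4_free_K: "C4_free (one_edges (K t))"
proof -
  have two_dots: "(i, j, l) \<in> {(1, 1, 3), (2, 2, 3), (3, 3, 4), (4, 1, 2), (5, 1, 4), (6, 2, 4)}"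
    if "(i, j) \<in> one_edges (K t)" "(i, l) \<in> one_edges (K t)" "j < l" for i j l
  proof -
    have grid: "(i, j) \<in> K_grid t" "(i, l) \<in> K_grid t"
      and one: "one_label (lab t (i, j))" "one_label (lab t (i, l))"
      using that by (simp_all add: one_edges_K)
    have jl: "j \<in> {1..4}" "l \<in> {1..4}" using grid by (auto simp: grid_def)
    from grid(1) show ?thesis
    proof (cases rule: K_grid_cases)
      case base
      then have il: "(i, l) \<in> grid 15 4" using grid(2) by (auto simp: grid_def)
      have "l \<in> set [1..<5]" using jl by simp
      then show ?thesis
        using base_two_dots[unfolded list_all_iff set_base_cells, THEN bspec, OF base, THEN bspec, of l]
          one that(3) lab_base[OF base] lab_base[OF il] by simp
    next
      case (u k c)
      then show ?thesis using one that(3) four_columns[OF jl(1)] four_columns[OF jl(2)] label_u[of k t l]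
        by (auto simp: lab_def)
    next
      case (v k c)
      then show ?thesis using one that(3) four_columns[OF jl(1)] four_columns[OF jl(2)] label_v[of k t l]
        by (auto simp: lab_def)
    next
      case (w c)
      then show ?thesis using one that(3) four_columns[OF jl(1)] four_columns[OF jl(2)] label_w[of t l]
        by (auto simp: lab_def)
    qed
  qed
  have False if "i \<noteq> k" "j < l" "(i, j) \<in> one_edges (K t)" "(i, l) \<in> one_edges (K t)"
    "(k, j) \<in> one_edges (K t)" "(k, l) \<in> one_edges (K t)" for i k j l
    using two_dots[OF that(3,4,2)] two_dots[OF that(5,6,2)] that(1) by auto
  then show ?thesis unfolding C4_free_def by (metis linorder_neqE_nat)
qed

section \<open>Certified two-edges\<close>

abbreviation settledK :: "nat \<Rightarrow> cell \<Rightarrow> cell \<Rightarrow> bool" where "settledK t \<equiv> settled (K t)"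

lemma settledK_line:
  "p \<in> K_grid t \<Longrightarrow> q \<in> K_grid t \<Longrightarrow> fst p = fst q \<or> snd p = snd q \<Longrightarrow> settledK t p q"
  by (rule settled_line) (simp_all add: occupied_K)

lemma settledK_swap:
  "settledK t (i, l) (k, j) \<Longrightarrow> (i, j) \<in> K_grid t \<Longrightarrow> (k, l) \<in> K_grid t \<Longrightarrow> settledK t (i, j) (k, l)"
  by (rule settled_swap) (auto simp: occupied_K grid_iff)

text \<open>Only the label of a two-edge that satisfies \<open>p \<sim> q\<close> is certified; before that its two cells must
  be told apart.\<close>

definition certified :: "nat \<Rightarrow> label \<Rightarrow> bool" where
  "certified t l \<longleftrightarrow> \<not> one_label l \<and> (\<forall>p \<in> K_grid t. \<forall>q \<in> K_grid t. lab t p = l \<longrightarrow> lab t q = l \<longrightarrow> settledK t p q)"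

lemma certifiedI:
  assumes "settledK t p q" "p \<in> K_grid t" "q \<in> K_grid t" "p \<noteq> q" "lab t p = l" "lab t q = l" "\<not> one_label l"
  shows "certified t l"
  unfolding certified_def
proof (intro conjI ballI impI)
  fix x y assume "x \<in> K_grid t" "y \<in> K_grid t" "lab t x = l" "lab t y = l"
  then have "x = p \<or> x = q" "y = p \<or> y = q"
    using same_label_at_most_two[of p t q] assms by auto
  moreover have "settledK t x x" if "x \<in> K_grid t" for x using that by (simp add: settledK_line)
  ultimately show "settledK t x y" using assms settled_sym by metis
qed (use assms in simp)

text \<open>Cells that may replace each other in a settled pair.\<close>

definition twin :: "nat \<Rightarrow> cell \<Rightarrow> cell \<Rightarrow> bool" where
  "twin t p q \<longleftrightarrow> p = q \<or> p \<in> K_grid t \<and> q \<in> K_grid t \<and> lab t p = lab t q \<and> certified t (lab t p)"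

lemma settledK_twin1:
  assumes "settledK t p q" "twin t p p'" "q \<in> K_grid t"
  shows "settledK t p' q"
proof (cases "p = p'")
  case False
  then have H: "p \<in> K_grid t" "p' \<in> K_grid t" "lab t p' = lab t p" "certified t (lab t p)" "\<not> one_label (lab t p)"
    using assms(2) by (auto simp: twin_def certified_def)
  show ?thesis
  proof (rule settled_along_edge[OF simple_K _ _ _ assms(1)])
    show "q \<in> occupied (K t)" using assms(3) by (simp add: occupied_K)
    show "same_edge (K t) p' p" using H by (auto intro: same_edge_K)
    show "settledK t p' p" using H unfolding certified_def by metis
  qed
qed (use assms in simp)

lemma settledK_twins:
  assumes "settledK t p q" "twin t p p'" "twin t q q'" "p' \<in> K_grid t" "q \<in> K_grid t"
  shows "settledK t p' q'"
  using settledK_twin1[OF assms(1,2,5)] assms(3,4) settled_sym settledK_twin1 by metis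

text \<open>The basic step of all derivations below: pass to twins, then exchange columns.\<close>

lemma settledK_twin_swap:
  assumes "settledK t p q" "twin t p (i, l)" "twin t q (k, j)" "q \<in> K_grid t" "(i, j) \<in> K_grid t" "(k, l) \<in> K_grid t"
  shows "settledK t (i, j) (k, l)"
  by (rule settledK_swap, rule settledK_twins[OF assms(1-3)]) (use assms in \<open>auto simp: grid_iff\<close>)

lemma in_K_grid: "(r, c) \<in> K_grid t \<longleftrightarrow> 0 < r \<and> r \<le> 16 + 2 * t \<and> 0 < c \<and> c \<le> 4"
  by (auto simp: grid_iff)

lemma lab_w: "lab t (16 + 2 * t, c) = [B 9, S t, A t, W] ! (c - 1)"
  by (simp add: lab_def label_w)

lemma lab_base_eval: "r \<le> 15 \<Longrightarrow> lab t (r, c) = base_rows ! (r - 1) ! (c - 1)"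
  by (simp add: lab_def label_base)

lemma certified_line_pairs: "certified t (B 1)" "certified t (B 19)" "certified t (B 21)"
  by (rule certifiedI[of t "(1, 2)" "(1, 4)"] certifiedI[of t "(12, 1)" "(12, 3)"]
      certifiedI[of t "(14, 1)" "(14, 2)"]; (rule settledK_line)?; simp add: in_K_grid lab_base_eval base_rows_eval)+

lemma certified_R: "i \<in> {1..t} \<Longrightarrow> certified t (R i)"
  using lab_R[of i t] by (intro certifiedI[of t "(14 + 2 * i, 4)" "(15 + 2 * i, 4)"] settledK_line) (auto simp: in_K_grid)

lemma settledK_complementary:
  assumes "i \<noteq> k" "j \<noteq> l" "(i, j) \<in> K_grid t" "(k, l) \<in> K_grid t"
    "\<not> one_label (lab t (i, j))" "\<not> one_label (lab t (i, l))"
    "lab t (i, j) = lab t (k, l)" "lab t (i, l) = lab t (k, j)"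
  shows "settledK t (i, j) (k, l)"
  by (rule settled_complementary_pair) (use assms in \<open>auto simp: two_edges_K in_K_grid\<close>)

text \<open>In rows 7, 8 and columns 3, 4, and again in rows 9, 10 and columns 2, 3, both diagonals are two-edges.\<close>

lemma certified_complementary: "certified t (B 11)" "certified t (B 13)" "certified t (B 14)" "certified t (B 16)"
  by (rule certifiedI[of t "(7, 3)" "(8, 4)"] certifiedI[of t "(7, 4)" "(8, 3)"]
      certifiedI[of t "(9, 3)" "(10, 2)"] certifiedI[of t "(9, 2)" "(10, 3)"];
     (rule settledK_complementary)?; simp add: in_K_grid lab_base_eval base_rows_eval)+

lemmas on_base = in_K_grid lab_base_eval base_rows_eval twin_def

lemma certified_17: "certified t (B 17)"
proof (rule certifiedI[of t "(10, 1)" "(12, 2)"])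
  have "settledK t (9, 3) (12, 3)" by (rule settledK_line) (simp_all add: on_base)
  then show "settledK t (10, 1) (12, 2)"
    by (rule settledK_twin_swap) (simp_all add: on_base certified_complementary certified_line_pairs)
qed (simp_all add: on_base)

lemma certified_15: "certified t (B 15)"
proof (rule certifiedI[of t "(9, 1)" "(11, 3)"])
  have "settledK t (12, 2) (11, 2)" by (rule settledK_line) (simp_all add: on_base)
  then have "settledK t (10, 2) (11, 1)"
    by (rule settledK_twin_swap) (simp_all add: on_base certified_17)
  then show "settledK t (9, 1) (11, 3)"
    by (rule settledK_twin_swap) (simp_all add: on_base certified_complementary)
qed (simp_all add: on_base)

lemma certified_18: "certified t (B 18)"
proof (rule certifiedI[of t "(11, 1)" "(15, 3)"])
  have "settledK t (9, 1) (15, 1)" by (rule settledK_line) (simp_all add: on_base)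
  then show "settledK t (11, 1) (15, 3)"
    by (rule settledK_twin_swap) (simp_all add: on_base certified_15)
qed (simp_all add: on_base)

lemma certified_20: "certified t (B 20)"
proof (rule certifiedI[of t "(14, 3)" "(15, 2)"])
  have "settledK t (14, 1) (11, 1)" by (rule settledK_line) (simp_all add: on_base)
  then show "settledK t (14, 3) (15, 2)"
    by (rule settledK_twin_swap) (simp_all add: on_base certified_18 certified_line_pairs)
qed (simp_all add: on_base)

lemma certified_10: "certified t (B 10)"
proof (rule certifiedI[of t "(6, 3)" "(11, 2)"])
  have "settledK t (10, 1) (6, 1)" by (rule settledK_line) (simp_all add: on_base)
  then have "settledK t (12, 1) (6, 2)"
    by (rule settledK_twin_swap) (simp_all add: on_base certified_17)
  then have "settledK t (12, 2) (6, 3)"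
    by (rule settledK_twin_swap) (simp_all add: on_base certified_line_pairs)
  then have "settledK t (10, 3) (6, 1)"
    by (rule settledK_twin_swap) (simp_all add: on_base certified_17)
  then have "settledK t (9, 1) (6, 2)"
    by (rule settledK_twin_swap) (simp_all add: on_base certified_complementary)
  then have "settledK t (11, 2) (6, 3)"
    by (rule settledK_twin_swap) (simp_all add: on_base certified_15)
  then show "settledK t (6, 3) (11, 2)" by (rule settled_sym)
qed (simp_all add: on_base)

lemma certified_5: "certified t (B 5)"
proof (rule certifiedI[of t "(15, 1)" "(3, 2)"])
  have "settledK t (15, 2) (3, 2)" by (rule settledK_line) (simp_all add: on_base)
  then have "settledK t (14, 2) (3, 3)"
    by (rule settledK_twin_swap) (simp_all add: on_base certified_20)
  then have "settledK t (14, 3) (3, 1)"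
    by (rule settledK_twin_swap) (simp_all add: on_base certified_line_pairs)
  then show "settledK t (15, 1) (3, 2)"
    by (rule settledK_twin_swap) (simp_all add: on_base certified_20)
qed (simp_all add: on_base)

lemma certified_6: "certified t (B 6)"
proof (rule certifiedI[of t "(6, 1)" "(4, 3)"])
  have "settledK t (14, 3) (4, 3)" by (rule settledK_line) (simp_all add: on_base)
  then have "settledK t (15, 3) (4, 2)"
    by (rule settledK_twin_swap) (simp_all add: on_base certified_20)
  then have "settledK t (11, 2) (4, 1)"
    by (rule settledK_twin_swap) (simp_all add: on_base certified_18)
  then show "settledK t (6, 1) (4, 3)"
    by (rule settledK_twin_swap) (simp_all add: on_base certified_10)
qed (simp_all add: on_base)

lemma certified_7: "certified t (B 7)"
proof (rule certifiedI[of t "(8, 1)" "(4, 4)"])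
  have "settledK t (6, 1) (7, 1)" by (rule settledK_line) (simp_all add: on_base)
  then have "settledK t (4, 1) (7, 3)"
    by (rule settledK_twin_swap) (simp_all add: on_base certified_6)
  then have "settledK t (4, 4) (8, 1)"
    by (rule settledK_twin_swap) (simp_all add: on_base certified_complementary)
  then show "settledK t (8, 1) (4, 4)" by (rule settled_sym)
qed (simp_all add: on_base)

lemma certified_12: "certified t (B 12)"
proof (rule certifiedI[of t "(7, 1)" "(13, 3)"])
  have "settledK t (4, 4) (13, 4)" by (rule settledK_line) (simp_all add: on_base)
  then have "settledK t (8, 4) (13, 1)"
    by (rule settledK_twin_swap) (simp_all add: on_base certified_7)
  then show "settledK t (7, 1) (13, 3)"
    by (rule settledK_twin_swap) (simp_all add: on_base certified_complementary)
qed (simp_all add: on_base)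

text \<open>Exchanging columns leads from the cells of \<open>S (i + 1)\<close> to a cell of \<open>S i\<close> and a cell in column 1, and \<open>S i\<close>
  has its other cell in column 1.  The start uses \<open>B 5\<close> in the role of a predecessor of \<open>S 0\<close>.\<close>

lemma certified_S: "i \<le> t \<Longrightarrow> certified t (S i)"
proof (induction i)
  case 0
  have "settledK t (15, 1) (if 0 = t then 16 + 2 * t else 17, 1)" by (rule settledK_line) (simp_all add: on_base)
  then have "settledK t (3, 1) (if 0 = t then 16 + 2 * t else 17, 2)"
    by (rule settledK_twin_swap) (simp_all add: on_base certified_5)
  then show ?case
    by (rule certifiedI) (use lab_S[of 0 t] in \<open>auto simp: on_base\<close>)
next
  case (Suc i)
  have "settledK t (if i = 0 then 3 else 15 + 2 * i, 1) (if Suc i = t then 16 + 2 * t else 19 + 2 * i, 1)"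
    using Suc.prems by (intro settledK_line) (auto simp: in_K_grid)
  then have "settledK t (17 + 2 * i, 1) (if Suc i = t then 16 + 2 * t else 19 + 2 * i, 2)"
    by (rule settledK_twin_swap)
      (use Suc lab_S[of i t] in \<open>auto simp: in_K_grid twin_def split: if_splits\<close>)
  then show ?case
    by (rule certifiedI) (use lab_S[of "Suc i" t] Suc.prems in \<open>auto simp: in_K_grid\<close>)
qed

lemma certified_9: "certified t (B 9)"
proof (rule certifiedI[of t "(16 + 2 * t, 1)" "(5, 2)"])
  have "settledK t (if t = 0 then 3 else 15 + 2 * t, 1) (5, 1)" by (rule settledK_line) (auto simp: in_K_grid)
  then show "settledK t (16 + 2 * t, 1) (5, 2)"
    by (rule settledK_twin_swap) (use lab_S[of t t] certified_S[of t t] in \<open>auto simp: in_K_grid twin_def\<close>)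
qed (simp_all add: on_base lab_w)

lemma certified_8: "certified t (B 8)"
proof (rule certifiedI[of t "(13, 2)" "(5, 3)"])
  have "settledK t (7, 1) (16 + 2 * t, 1)" by (rule settledK_line) (simp_all add: on_base)
  then show "settledK t (13, 2) (5, 3)"
    by (rule settledK_twin_swap) (simp_all add: on_base lab_w certified_9 certified_12)
qed (simp_all add: on_base)

text \<open>Here the roles are reversed: the cells of \<open>A i\<close> lead to \<open>A (i + 1)\<close> and a cell in column 3, where \<open>A (i + 1)\<close>
  has its other cell.  The start \<open>A t\<close> is reached through \<open>B 9\<close> and \<open>B 8\<close>.\<close>

lemma certified_A: "i \<le> t \<Longrightarrow> certified t (A i)"
proof (induction i rule: inc_induct)
  case base
  let ?r = "if t = 0 then 2 else 14 + 2 * t"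
  have "settledK t (13, 2) (?r, 2)" by (rule settledK_line) (auto simp: in_K_grid)
  then have "settledK t (5, 2) (?r, 3)"
    by (rule settledK_twin_swap) (simp_all add: on_base certified_8)
  then have "settledK t (16 + 2 * t, 3) (?r, 1)"
    by (rule settledK_twin_swap) (simp_all add: on_base certified_9 lab_w)
  then show ?case
    by (rule certifiedI) (use lab_A[of t t] in \<open>simp_all add: on_base\<close>)
next
  case (step i)
  let ?r = "if i = 0 then 2 else 14 + 2 * i"
  have "settledK t (18 + 2 * i, 3) (?r, 3)" using step.hyps by (intro settledK_line) (auto simp: in_K_grid)
  then have "settledK t (16 + 2 * i, 3) (?r, 1)"
    by (rule settledK_twin_swap) (use step lab_A[of "Suc i" t] in \<open>auto simp: in_K_grid twin_def\<close>)
  then show ?case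
    by (rule certifiedI) (use step.hyps lab_A[of i t] in \<open>auto simp: in_K_grid\<close>)
qed

lemma certified_3: "certified t (B 3)"
proof (rule certifiedI[of t "(2, 4)" "(13, 1)"])
  have "settledK t (7, 4) (16, 1)"
  proof (cases "t = 0")
    case True
    have "settledK t (13, 2) (8, 2)" by (rule settledK_line) (simp_all add: on_base)
    then have "settledK t (5, 2) (8, 3)"
      by (rule settledK_twin_swap) (simp_all add: on_base certified_8)
    then have "settledK t (16 + 2 * t, 1) (7, 4)"
      by (rule settledK_twins) (simp_all add: on_base lab_w certified_complementary certified_9)
    then show ?thesis using True by (simp add: settled_sym)
  next
    case False
    have "settledK t (8, 3) (18, 3)" using False by (intro settledK_line) (simp_all add: on_base)
    then show ?thesis
      by (rule settledK_twins) (use False lab_A[of 1 t] certified_A[of 1 t] in \<open>simp_all add: on_base certified_complementary\<close>)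
  qed
  then have "settledK t (7, 1) (16, 4)"
    by (rule settledK_twin_swap) (simp_all add: on_base)
  then have "settledK t (13, 4) (16, 3)"
    by (rule settledK_twin_swap) (simp_all add: on_base certified_12)
  then have "settledK t (13, 1) (2, 4)"
    by (rule settledK_twin_swap) (use lab_A[of 0 t] certified_A[of 0 t] in \<open>simp_all add: on_base\<close>)
  then show "settledK t (2, 4) (13, 1)" by (rule settled_sym)
qed (simp_all add: on_base)

section \<open>The recursive tail\<close>

definition linked :: "nat \<Rightarrow> label \<Rightarrow> label \<Rightarrow> bool" where
  "linked t l l' \<longleftrightarrow> (\<forall>p \<in> K_grid t. \<forall>q \<in> K_grid t. lab t p = l \<longrightarrow> lab t q = l' \<longrightarrow> settledK t p q)"

text \<open>One settled pair of occurrences of two rigid labels settles all others.  \<open>Dot\<close> is not rigid, being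
  the common label of unrelated one-edges.\<close>

definition rigid :: "nat \<Rightarrow> label \<Rightarrow> bool" where
  "rigid t l \<longleftrightarrow> (\<forall>p \<in> K_grid t. \<forall>q \<in> K_grid t. lab t p = l \<longrightarrow> lab t q = l \<longrightarrow> twin t p q)"

lemma linked_sym: "linked t l l' \<Longrightarrow> linked t l' l"
  unfolding linked_def using settled_sym by blast

lemma linkedI:
  assumes "settledK t p q" "p \<in> K_grid t" "q \<in> K_grid t" "rigid t (lab t p)" "rigid t (lab t q)"
  shows "linked t (lab t p) (lab t q)"
  unfolding linked_def using assms settledK_twins unfolding rigid_def by metis

lemma linked_line:
  assumes "p \<in> K_grid t" "q \<in> K_grid t" "rigid t (lab t p)" "rigid t (lab t q)"
    and "fst p = fst q \<or> snd p = snd q"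
  shows "linked t (lab t p) (lab t q)"
  using assms by (intro linkedI settledK_line)

lemma linked_swap:
  assumes "linked t (lab t (i, l)) (lab t (k, j))"
    and "(i, j) \<in> K_grid t" "(k, l) \<in> K_grid t" "rigid t (lab t (i, j))" "rigid t (lab t (k, l))"
  shows "linked t (lab t (i, j)) (lab t (k, l))"
proof (rule linkedI)
  have "settledK t (i, l) (k, j)" using assms(1-3) unfolding linked_def by (simp add: in_K_grid)
  then show "settledK t (i, j) (k, l)" using assms(2,3) by (rule settledK_swap)
qed (use assms in auto)

lemma lab_u: "i \<in> {1..t} \<Longrightarrow> lab t (14 + 2 * i, c) = [A i, U i, A (i - 1), R i] ! (c - 1)"
  by (simp add: lab_def label_u)

lemma lab_v: "i \<in> {1..t} \<Longrightarrow> lab t (15 + 2 * i, c) = [S i, S (i - 1), V i, R i] ! (c - 1)"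
  by (simp add: lab_def label_v)

lemma lab_one_chain:
  assumes "p \<in> K_grid t"
  shows "lab t p = U i \<Longrightarrow> p = (14 + 2 * i, 2)" "lab t p = V i \<Longrightarrow> p = (15 + 2 * i, 3)"
    "lab t p = W \<Longrightarrow> p = (16 + 2 * t, 4)"
proof -
  have "(lab t p = U i \<longrightarrow> p = (14 + 2 * i, 2)) \<and> (lab t p = V i \<longrightarrow> p = (15 + 2 * i, 3)) \<and>
    (lab t p = W \<longrightarrow> p = (16 + 2 * t, 4))"
    using assms
  proof (cases rule: K_grid_cases)
    case base
    from base show ?thesis by (cases rule: base_cases) (use base in \<open>auto simp: lab_base\<close>)
  next
    case (u k c)
    then show ?thesis using four_columns[of c] by auto
  next
    case (v k c)
    then show ?thesis using four_columns[of c] by auto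
  next
    case (w c)
    then show ?thesis using four_columns[of c] by auto
  qed
  then show "lab t p = U i \<Longrightarrow> p = (14 + 2 * i, 2)" "lab t p = V i \<Longrightarrow> p = (15 + 2 * i, 3)"
    "lab t p = W \<Longrightarrow> p = (16 + 2 * t, 4)" by blast+
qed

lemma rigid_certified: "certified t l \<Longrightarrow> rigid t l"
  by (simp add: rigid_def twin_def)

lemma rigid_chain [simp]:
  "i \<le> t \<Longrightarrow> rigid t (A i)" "i \<le> t \<Longrightarrow> rigid t (S i)" "i \<in> {1..t} \<Longrightarrow> rigid t (R i)"
  "rigid t (U i)" "rigid t (V i)" "rigid t W" "rigid t (B 9)"
proof -
  show "rigid t (U i)" "rigid t (V i)" "rigid t W"
    unfolding rigid_def twin_def using lab_one_chain[of _ t] by metis+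
qed (simp_all add: rigid_certified certified_A certified_S certified_R certified_9)

text \<open>Flipping and shifting together replace \<open>(i, j)\<close> by \<open>(i + 1, j - 1)\<close>.  For \<open>i < j\<close> this ends in \<open>(i, i)\<close> or in
  \<open>(j - 1, j)\<close>, depending on the parity of \<open>i + j\<close>.  All indices in between stay in the range, so that no
  special treatment of the ends of the tail is needed.\<close>

lemma zigzag:
  assumes diag: "\<And>i. i \<in> {1..t} \<Longrightarrow> P i i"
    and adjacent: "\<And>j. j \<in> {1..t} \<Longrightarrow> P (j - 1) j"
    and flip: "\<And>i j. i \<in> {1..t} \<Longrightarrow> j \<in> {1..t} \<Longrightarrow> P j i \<Longrightarrow> P i j"
    and shift: "\<And>i j. i \<in> {1..t} \<Longrightarrow> j \<in> {1..t} \<Longrightarrow> P (j - 1) i \<Longrightarrow> P (i - 1) j"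
    and "i \<le> t" "j \<in> {1..t::nat}"
  shows "P i j"
proof -
  have less: "P i j" if "i < j" "j \<le> t" for i j
    using that
  proof (induction "j - i" arbitrary: i j rule: less_induct)
    case less
    consider "i = j - 1" | "i + 1 = j - 1" | "i + 1 < j - 1" using less.prems by linarith
    then show ?case
    proof cases
      case 1
      then show ?thesis using adjacent[of j] less.prems by simp
    next
      case 2
      then have "P (j - 1) (i + 1)" using diag[of "i + 1"] less.prems by simp
      then show ?thesis using shift[of "i + 1" j] less.prems by simp
    next
      case 3
      then have "P (i + 1) (j - 1)" using less.prems by (intro less.hyps) linarith+
      then have "P (j - 1) (i + 1)" using flip[of "j - 1" "i + 1"] 3 less.prems by simp
      then show ?thesis using shift[of "i + 1" j] less.prems by simp
    qed
  qed
  consider "i < j" | "i = j" | "j < i" by linarith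
  then show ?thesis
    using less[of i j] less[of j i] diag[of i] flip[of i j] assms(5,6) by cases auto
qed

text \<open>The labels that occur in the rows from 16 on.\<close>

fun chain_label :: "nat \<Rightarrow> label \<Rightarrow> bool" where
  "chain_label t (A i) = (i \<le> t)"
| "chain_label t (S i) = (i \<le> t)"
| "chain_label t (R i) = (i \<in> {1..t})"
| "chain_label t (U i) = (i \<in> {1..t})"
| "chain_label t (V i) = (i \<in> {1..t})"
| "chain_label t W = True"
| "chain_label t (B j) = (j = 9)"
| "chain_label t Dot = False"

lemma in_rows:
  "i \<in> {1..t} \<Longrightarrow> (14 + 2 * i, c) \<in> K_grid t \<longleftrightarrow> c \<in> {1..4}"
  "i \<in> {1..t} \<Longrightarrow> (15 + 2 * i, c) \<in> K_grid t \<longleftrightarrow> c \<in> {1..4}"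
  "(16 + 2 * t, c) \<in> K_grid t \<longleftrightarrow> c \<in> {1..4}"
  by (auto simp: in_K_grid)

lemmas on_chain = lab_u lab_v lab_w in_rows

text \<open>In the rows \<open>14 + 2 * i\<close> and \<open>14 + 2 * j\<close>, exchanging the columns 1 and 2 flips the indices, and exchanging
  the columns 2 and 3 shifts them.\<close>

lemma linked_A_U: "i \<le> t \<Longrightarrow> j \<in> {1..t} \<Longrightarrow> linked t (A i) (U j)"
proof (rule zigzag[where P = "\<lambda>i j. linked t (A i) (U j)" and t = t])
  fix i assume i: "i \<in> {1..t}"
  show "linked t (A i) (U i)" "linked t (A (i - 1)) (U i)"
    using linked_line[of "(14 + 2 * i, 1)" t "(14 + 2 * i, 2)"] linked_line[of "(14 + 2 * i, 3)" t "(14 + 2 * i, 2)"] i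
    by (auto simp: on_chain)
  fix j assume j: "j \<in> {1..t}"
  show "linked t (A i) (U j)" if "linked t (A j) (U i)"
    using linked_swap[of t "14 + 2 * i" 2 "14 + 2 * j" 1] linked_sym[OF that] i j by (auto simp: on_chain)
  show "linked t (A (i - 1)) (U j)" if "linked t (A (j - 1)) (U i)"
    using linked_swap[of t "14 + 2 * i" 2 "14 + 2 * j" 3] linked_sym[OF that] i j by (auto simp: on_chain)
qed

lemma linked_A_R: "i \<le> t \<Longrightarrow> j \<in> {1..t} \<Longrightarrow> linked t (A i) (R j)"
proof (rule zigzag[where P = "\<lambda>i j. linked t (A i) (R j)" and t = t])
  fix i assume i: "i \<in> {1..t}"
  show "linked t (A i) (R i)" "linked t (A (i - 1)) (R i)"
    using linked_line[of "(14 + 2 * i, 1)" t "(14 + 2 * i, 4)"] linked_line[of "(14 + 2 * i, 3)" t "(14 + 2 * i, 4)"] i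
    by (auto simp: on_chain)
  fix j assume j: "j \<in> {1..t}"
  show "linked t (A i) (R j)" if "linked t (A j) (R i)"
    using linked_swap[of t "14 + 2 * i" 4 "14 + 2 * j" 1] linked_sym[OF that] i j by (auto simp: on_chain)
  show "linked t (A (i - 1)) (R j)" if "linked t (A (j - 1)) (R i)"
    using linked_swap[of t "14 + 2 * i" 4 "14 + 2 * j" 3] linked_sym[OF that] i j by (auto simp: on_chain)
qed

lemma linked_S_V: "i \<le> t \<Longrightarrow> j \<in> {1..t} \<Longrightarrow> linked t (S i) (V j)"
proof (rule zigzag[where P = "\<lambda>i j. linked t (S i) (V j)" and t = t])
  fix i assume i: "i \<in> {1..t}"
  show "linked t (S i) (V i)" "linked t (S (i - 1)) (V i)"
    using linked_line[of "(15 + 2 * i, 1)" t "(15 + 2 * i, 3)"] linked_line[of "(15 + 2 * i, 2)" t "(15 + 2 * i, 3)"] i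
    by (auto simp: on_chain)
  fix j assume j: "j \<in> {1..t}"
  show "linked t (S i) (V j)" if "linked t (S j) (V i)"
    using linked_swap[of t "15 + 2 * i" 3 "15 + 2 * j" 1] linked_sym[OF that] i j by (auto simp: on_chain)
  show "linked t (S (i - 1)) (V j)" if "linked t (S (j - 1)) (V i)"
    using linked_swap[of t "15 + 2 * i" 3 "15 + 2 * j" 2] linked_sym[OF that] i j by (auto simp: on_chain)
qed

lemma linked_S_R:
  assumes i: "i \<le> t" and j: "j \<in> {1..t}"
  shows "linked t (S i) (R j)"
proof -
  have pos: "linked t (S i) (R j)" if "i \<in> {1..t}" "j \<in> {1..t}" for i j
    using linked_swap[of t "15 + 2 * i" 4 "14 + 2 * j" 1] linked_sym[OF linked_A_R[of j t i]] that
    by (simp add: on_chain)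
  have "linked t (S 0) (R j)"
  proof (cases "j = 1")
    case True
    then show ?thesis
      using linked_line[of "(15 + 2 * 1, 2)" t "(15 + 2 * 1, 4)"] j lab_v[of 1 t] in_rows(2)[of 1 t] by simp
  next
    case False
    then have "j - 1 \<in> {1..t}" "1 \<in> {1..t}" using j by auto
    then have "linked t (R 1) (S (j - 1))" using pos linked_sym by blast
    then show ?thesis
      using linked_swap[of t "15 + 2 * 1" 4 "15 + 2 * j" 2] j lab_v[of 1 t] in_rows(2)[of 1 t]
      by (simp add: on_chain)
  qed
  then show ?thesis using pos[of i] assms by (cases "i = 0") auto
qed

lemma linked_dots:
  assumes i: "i \<in> {1..t}" and j: "j \<in> {1..t}"
  shows "linked t (V i) (R j)" "linked t (U i) (R j)" "linked t (U i) (V j)"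
proof -
  have ij: "j - 1 \<le> t" "i - 1 \<le> t" using i j by auto
  show "linked t (V i) (R j)"
    using linked_swap[of t "15 + 2 * i" 4 "14 + 2 * j" 3] linked_sym[OF linked_A_R[OF ij(1) i]] i j
    by (simp add: on_chain)
  show "linked t (U i) (R j)"
    using linked_swap[of t "14 + 2 * i" 4 "15 + 2 * j" 2] linked_sym[OF linked_S_R[OF ij(1) i]] i j
    by (simp add: on_chain)
  have "settledK t (if i - 1 = 0 then 2 else 14 + 2 * (i - 1), 1) (if j - 1 = 0 then 3 else 15 + 2 * (j - 1), 1)"
    by (rule settledK_line) (use i j in \<open>auto simp: in_K_grid\<close>)
  then have "linked t (A (i - 1)) (S (j - 1))"
    using lab_A(1)[OF ij(2)] lab_S(1)[OF ij(1)] linkedI[of t "(if i - 1 = 0 then 2 else 14 + 2 * (i - 1), 1)" "(if j - 1 = 0 then 3 else 15 + 2 * (j - 1), 1)"]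
      ij i j by (simp add: in_K_grid del: One_nat_def)
  then show "linked t (U i) (V j)"
    using linked_swap[of t "14 + 2 * i" 3 "15 + 2 * j" 2] i j by (simp add: on_chain)
qed

text \<open>Pairs of families that share a column.\<close>

lemma linked_columns:
  assumes "i \<le> t" "j \<le> t"
  shows "linked t (A i) (A j)" "linked t (A i) (S j)" "linked t (S i) (S j)"
    "linked t (A i) (B 9)" "linked t (S i) (B 9)"
proof -
  let ?a = "\<lambda>i. (if i = 0 then 2 else 14 + 2 * i, 1) :: cell" and ?s = "\<lambda>i. (if i = 0 then 3 else 15 + 2 * i, 1) :: cell"
  have "lab t (?a i) = A i" "lab t (?a j) = A j" "lab t (?s i) = S i" "lab t (?s j) = S j"
    "lab t (16 + 2 * t, 1) = B 9"
    using lab_A(1)[of i t] lab_A(1)[of j t] lab_S(1)[of i t] lab_S(1)[of j t] assms by (simp_all add: lab_w)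
  moreover have "?a i \<in> K_grid t" "?a j \<in> K_grid t" "?s i \<in> K_grid t" "?s j \<in> K_grid t" "(16 + 2 * t, 1) \<in> K_grid t"
    using assms by (auto simp: in_K_grid)
  ultimately show "linked t (A i) (A j)" "linked t (A i) (S j)" "linked t (S i) (S j)"
    "linked t (A i) (B 9)" "linked t (S i) (B 9)"
    using linked_line[of "?a i" t "?a j"] linked_line[of "?a i" t "?s j"] linked_line[of "?s i" t "?s j"]
      linked_line[of "?a i" t "(16 + 2 * t, 1)"] linked_line[of "?s i" t "(16 + 2 * t, 1)"] assms
    by simp_all
qed

lemma linked_more_columns:
  assumes "i \<le> t" "j \<in> {1..t}" "k \<in> {1..t}"
  shows "linked t (A i) (V j)" "linked t (S i) (U j)" "linked t (B 9) (U j)"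
    "linked t (U k) (U j)" "linked t (V k) (V j)" "linked t (R k) (R j)" "linked t (R j) W"
proof -
  let ?s = "(if i = t then 16 + 2 * t else 17 + 2 * i, 2) :: cell"
  have "lab t (16 + 2 * i, 3) = A i" "lab t ?s = S i" "lab t (5, 2) = B 9"
    using lab_A(2)[of i t] lab_S(2)[of i t] assms by (simp_all add: on_base)
  moreover have "(16 + 2 * i, 3) \<in> K_grid t" "?s \<in> K_grid t" "(5, 2) \<in> K_grid t"
    using assms by (auto simp: in_K_grid)
  ultimately show "linked t (A i) (V j)" "linked t (S i) (U j)" "linked t (B 9) (U j)"
    "linked t (U k) (U j)" "linked t (V k) (V j)" "linked t (R k) (R j)" "linked t (R j) W"
    using linked_line[of "(16 + 2 * i, 3)" t "(15 + 2 * j, 3)"] linked_line[of ?s t "(14 + 2 * j, 2)"]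
      linked_line[of "(5, 2)" t "(14 + 2 * j, 2)"] linked_line[of "(14 + 2 * k, 2)" t "(14 + 2 * j, 2)"]
      linked_line[of "(15 + 2 * k, 3)" t "(15 + 2 * j, 3)"] linked_line[of "(14 + 2 * k, 4)" t "(14 + 2 * j, 4)"]
      linked_line[of "(14 + 2 * j, 4)" t "(16 + 2 * t, 4)"] assms
    by (simp_all add: on_chain)
qed

lemma linked_W:
  shows "i \<le> t \<Longrightarrow> linked t W (A i)" "i \<le> t \<Longrightarrow> linked t W (S i)"
    "j \<in> {1..t} \<Longrightarrow> linked t W (U j)" "j \<in> {1..t} \<Longrightarrow> linked t W (V j)"
    "linked t W (B 9)" "linked t W W" "linked t (B 9) (B 9)"
proof -
  let ?w = "16 + 2 * t"
  show "linked t W (B 9)" "linked t W W" "linked t (B 9) (B 9)"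
    using linked_line[of "(?w, 4)" t "(?w, 1)"] linked_line[of "(?w, 4)" t "(?w, 4)"] linked_line[of "(?w, 1)" t "(?w, 1)"]
    by (simp_all add: on_chain)
  show "linked t W (A i)" if "i \<le> t"
  proof (cases "i = t")
    case True
    then show ?thesis using linked_line[of "(?w, 4)" t "(?w, 3)"] by (simp add: on_chain)
  next
    case False
    then have k: "i + 1 \<in> {1..t}" using that by simp
    show ?thesis
      using linked_swap[of t ?w 3 "14 + 2 * (i + 1)" 4] linked_A_R[of t t "i + 1"] that k
      unfolding lab_u[OF k] in_rows(1)[OF k] by (simp add: lab_w in_rows)
  qed
  show "linked t W (S i)" if "i \<le> t"
  proof (cases "i = t")
    case True
    then show ?thesis using linked_line[of "(?w, 4)" t "(?w, 2)"] by (simp add: on_chain)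
  next
    case False
    then have k: "i + 1 \<in> {1..t}" using that by simp
    show ?thesis
      using linked_swap[of t ?w 2 "15 + 2 * (i + 1)" 4] linked_S_R[of t t "i + 1"] that k
      unfolding lab_v[OF k] in_rows(2)[OF k] by (simp add: lab_w in_rows)
  qed
  assume j: "j \<in> {1..t}"
  show "linked t W (U j)"
    using linked_swap[of t ?w 2 "14 + 2 * j" 4] linked_S_R[of t t j] j by (simp add: on_chain)
  show "linked t W (V j)"
    using linked_swap[of t ?w 3 "15 + 2 * j" 4] linked_A_R[of t t j] j by (simp add: on_chain)
qed

lemma linked_B9:
  assumes "j \<in> {1..t}"
  shows "linked t (B 9) (R j)" "linked t (B 9) (V j)"
  using linked_swap[of t "16 + 2 * t" 4 "14 + 2 * j" 1] linked_W(1)[of j t]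
    linked_swap[of t "16 + 2 * t" 3 "15 + 2 * j" 1] linked_columns(2)[of t t j] assms
  by (simp_all add: on_chain)

lemma linked_chain: "chain_label t l \<Longrightarrow> chain_label t l' \<Longrightarrow> linked t l l'"
  by (cases l; cases l')
    (auto simp: linked_A_U linked_A_R linked_S_V linked_S_R linked_dots linked_columns linked_more_columns linked_W linked_B9
      linked_A_U[THEN linked_sym] linked_A_R[THEN linked_sym] linked_S_V[THEN linked_sym] linked_S_R[THEN linked_sym]
      linked_dots[THEN linked_sym] linked_columns[THEN linked_sym] linked_more_columns[THEN linked_sym] linked_W[THEN linked_sym] linked_B9[THEN linked_sym])

section \<open>Searching for rectangle swaps\<close>

text \<open>A tag names a set of cells that are pairwise settled for a known reason: the cells of a line, or the
  cells labelled \<open>A\<close>, labelled \<open>S\<close>, or labelled as in the tail.\<close>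

datatype tag = Row nat | Column nat | A_cells | S_cells | Chain

text \<open>An entry \<open>(ps, hs, ks)\<close> collects what is known about a cell: \<open>ps\<close> are cells that may replace it, \<open>hs\<close> are
  the tags of these cells, and \<open>ks\<close> are tags such that the cell is settled with all cells that carry them.\<close>

type_synonym entry = "cell list \<times> tag list \<times> tag list"

text \<open>Agrees with \<open>(!)\<close>, but evaluates without an intermediate case expression.\<close>

fun at :: "'a list \<Rightarrow> nat \<Rightarrow> 'a" where
  "at (x # xs) 0 = x"
| "at (x # xs) (Suc n) = at xs n"

lemma at_eq_nth: "n < length xs \<Longrightarrow> at xs n = xs ! n"
  by (induction xs n rule: at.induct) auto

fun look :: "'a list list \<Rightarrow> cell \<Rightarrow> 'a" where
  "look T (r, c) = at (at T r) c"

fun shared :: "'a list \<Rightarrow> 'a list \<Rightarrow> bool" where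
  "shared [] ys = False"
| "shared (x # xs) ys = (if List.member ys x then True else shared xs ys)"

fun direct :: "entry \<Rightarrow> entry \<Rightarrow> bool" where
  "direct (ps, hs, ks) (qs, hs', ks') =
    (if shared hs hs' then True else if shared ks hs' then True else shared ks' hs)"

text \<open>After an exchange of columns has led to \<open>(p, q)\<close>, exchanging again without passing to another
  cell first would lead back.\<close>

definition other_choices :: "cell \<Rightarrow> cell \<Rightarrow> entry \<Rightarrow> entry \<Rightarrow> (cell \<times> cell) list" where
  "other_choices p q e e' = remove1 (p, q) (List.product (fst e) (fst e'))"

text \<open>Depth-first search for a chain of moves.  The list holds the choices still to be tried, all of them
  replacements for the same pair, and \<open>n\<close> bounds the length of the chain.  As the last move is never undone,
  hardly any branching is left: a pair of one-edges is a dead end, and a one-edge with a two-edge usually has a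
  single continuation.

  Each conditional is a function of its own, defined by cases on a Boolean.  Thus all arguments
  are evaluated before a branch is taken, and the table, which is large, is passed on without being
  rewritten again.\<close>

function search :: "entry list list \<Rightarrow> nat \<Rightarrow> (cell \<times> cell) list \<Rightarrow> bool"
  and visit :: "entry list list \<Rightarrow> nat \<Rightarrow> (cell \<times> cell) list \<Rightarrow> cell \<Rightarrow> cell \<Rightarrow> entry \<Rightarrow> entry \<Rightarrow> bool"
  and branch :: "entry list list \<Rightarrow> nat \<Rightarrow> (cell \<times> cell) list \<Rightarrow> cell \<Rightarrow> cell \<Rightarrow> entry \<Rightarrow> entry \<Rightarrow> bool \<Rightarrow> bool"
  and next_choice :: "entry list list \<Rightarrow> nat \<Rightarrow> (cell \<times> cell) list \<Rightarrow> bool \<Rightarrow> bool"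
where
  "search T n [] = False"
| "search T 0 (x # xs) = False"
| "search T (Suc n) (((r, a), (s, b)) # xs) =
     visit T n xs (r, b) (s, a) (look T (r, b)) (look T (s, a))"
| "visit T n xs p q e e' = branch T n xs p q e e' (direct e e')"
| "branch T n xs p q e e' True = True"
| "branch T n xs p q e e' False = next_choice T n xs (search T n (other_choices p q e e'))"
| "next_choice T n xs True = True"
| "next_choice T n xs False = search T (Suc n) xs"
  by pat_completeness auto
termination
  by (relation "inv_image (less_than <*lex*> less_than) (\<lambda>x. case x of
      Inl (Inl (T, n, xs)) \<Rightarrow> (n, 4 * length xs)
    | Inl (Inr (T, n, xs, _)) \<Rightarrow> (Suc n, 4 * length xs + 3)
    | Inr (Inl (T, n, xs, _)) \<Rightarrow> (Suc n, 4 * length xs + 2)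
    | Inr (Inr (T, n, xs, _)) \<Rightarrow> (Suc n, 4 * length xs + 1))") auto

text \<open>Enough for the two tables to which the search is applied.\<close>

definition fuel :: nat where "fuel = 20"

fun connected_by where
  "connected_by T e e' True = True"
| "connected_by T e e' False = search T fuel (List.product (fst e) (fst e'))"

definition connected :: "entry list list \<Rightarrow> entry \<Rightarrow> entry \<Rightarrow> bool" where
  "connected T e e' = connected_by T e e' (direct e e')"

fun connected_all :: "entry list list \<Rightarrow> entry \<Rightarrow> cell list \<Rightarrow> bool" where
  "connected_all T e [] = True"
| "connected_all T e (q # qs) = (connected T e (look T q) \<and> connected_all T e qs)"

fun learn :: "tag \<Rightarrow> bool \<Rightarrow> entry \<Rightarrow> entry" where
  "learn k b (ps, hs, ks) = (ps, hs, if b then List.insert k ks else ks)"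

text \<open>A rule \<open>(k, qs)\<close> says that a cell which is settled with all of \<open>qs\<close> is settled with every cell tagged \<open>k\<close>.\<close>

fun improve :: "entry list list \<Rightarrow> (tag \<times> cell list) list \<Rightarrow> entry \<Rightarrow> entry" where
  "improve T [] e = e"
| "improve T ((k, qs) # Rs) e = improve T Rs (learn k (connected_all T e qs) e)"

fun rounds :: "nat \<Rightarrow> (tag \<times> cell list) list \<Rightarrow> entry list list \<Rightarrow> entry list list" where
  "rounds 0 Rs T = T"
| "rounds (Suc n) Rs T = rounds n Rs (map (map (improve T Rs)) T)"

definition connected_cells :: "entry list list \<Rightarrow> cell \<Rightarrow> cell \<Rightarrow> bool" where
  "connected_cells T p q = connected T (look T p) (look T q)"

definition cells :: "nat \<Rightarrow> cell list" where
  "cells n = List.product [0..<n] [0..<4]"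

definition all_connected :: "entry list list \<Rightarrow> bool" where
  "all_connected T = sorted_wrt (connected_cells T) (cells (length T))"

section \<open>Soundness of the search\<close>

definition window :: "nat \<Rightarrow> cell set" where "window n = {..<n} \<times> {..<4}"

text \<open>What the search relies on: a relation on the cells of an \<open>n \<times> 4\<close> grid, counted from 0, that is
  closed under exchanging columns.\<close>

locale swap_relation =
  fixes n :: nat and Q :: "cell \<Rightarrow> cell \<Rightarrow> bool" and Tag :: "tag \<Rightarrow> cell set"
  assumes refl: "p \<in> window n \<Longrightarrow> Q p p"
    and sym: "Q p q \<Longrightarrow> Q q p"
    and swap: "(r, a) \<in> window n \<Longrightarrow> (s, b) \<in> window n \<Longrightarrow> Q (r, b) (s, a) \<Longrightarrow> Q (r, a) (s, b)"
    and tag: "p \<in> window n \<Longrightarrow> q \<in> window n \<Longrightarrow> p \<in> Tag h \<Longrightarrow> q \<in> Tag h \<Longrightarrow> Q p q"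
begin

text \<open>The cell \<open>a\<close> may replace \<open>p\<close>.  This is not symmetric: below, \<open>a\<close> may stand for a whole family of cells
  and \<open>p\<close> for one member of it.\<close>

definition forces :: "cell \<Rightarrow> cell \<Rightarrow> bool" where
  "forces a p \<longleftrightarrow> a \<in> window n \<and> (\<forall>q \<in> window n. Q a q \<longrightarrow> Q p q)"

fun sound_entry :: "cell \<Rightarrow> entry \<Rightarrow> bool" where
  "sound_entry p (ps, hs, ks) \<longleftrightarrow> p \<in> window n \<and> (\<forall>a \<in> set ps. forces a p) \<and>
     (\<forall>h \<in> set hs. \<exists>a \<in> Tag h. forces a p) \<and> (\<forall>k \<in> set ks. \<forall>q \<in> Tag k \<inter> window n. Q p q)"

definition sound_table :: "entry list list \<Rightarrow> bool" where
  "sound_table T \<longleftrightarrow> (\<forall>p \<in> window n. sound_entry p (look T p))"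

lemma forces2: "forces a p \<Longrightarrow> forces b q \<Longrightarrow> p \<in> window n \<Longrightarrow> q \<in> window n \<Longrightarrow> Q a b \<Longrightarrow> Q p q"
  unfolding forces_def using sym by blast

lemma sound_entry_window: "sound_entry p e \<Longrightarrow> p \<in> window n"
  by (cases e) simp

lemma shared_iff: "shared xs ys \<longleftrightarrow> set xs \<inter> set ys \<noteq> {}"
  by (induction xs ys rule: shared.induct) auto

lemma direct_sound:
  assumes "direct e e'" "sound_entry p e" "sound_entry q e'"
  shows "Q p q"
proof -
  obtain ps hs ks qs hs' ks' where e: "e = (ps, hs, ks)" "e' = (qs, hs', ks')"
    by (cases e; cases e') auto
  then have pq: "p \<in> window n" "q \<in> window n" using assms by simp_all
  consider h where "h \<in> set hs" "h \<in> set hs'" | h where "h \<in> set ks" "h \<in> set hs'"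
    | h where "h \<in> set ks'" "h \<in> set hs"
    using assms(1) by (auto simp: e shared_iff split: if_splits)
  then show ?thesis
  proof cases
    case 1
    then have "\<exists>a \<in> Tag h. forces a p" "\<exists>b \<in> Tag h. forces b q" using assms(2,3) e by simp_all
    then obtain a b where "a \<in> Tag h" "b \<in> Tag h" "forces a p" "forces b q" by blast
    then show ?thesis using tag forces2 pq unfolding forces_def by blast
  next
    case 2
    then obtain b where "b \<in> Tag h" "forces b q" "\<forall>q \<in> Tag h \<inter> window n. Q p q" using assms e by auto
    then show ?thesis using pq sym unfolding forces_def by blast
  next
    case 3
    then obtain b where "b \<in> Tag h" "forces b p" "\<forall>p \<in> Tag h \<inter> window n. Q q p" using assms e by auto
    then show ?thesis using pq sym unfolding forces_def by blast
  qed
qed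

lemma choice_sound:
  assumes "sound_entry p e" "sound_entry q e'" "(x, y) \<in> set (List.product (fst e) (fst e'))" "Q x y"
  shows "Q p q"
  using assms forces2[of x p y q] by (cases e; cases e') auto

lemma choice_window:
  assumes "sound_entry p e" "sound_entry q e'"
  shows "set (List.product (fst e) (fst e')) \<subseteq> window n \<times> window n"
  using assms by (cases e; cases e') (auto simp: forces_def)

abbreviation inside :: "(cell \<times> cell) list \<Rightarrow> bool" where
  "inside xs \<equiv> set xs \<subseteq> window n \<times> window n"

definition good :: "(cell \<times> cell) list \<Rightarrow> bool" where
  "good xs \<longleftrightarrow> (\<exists>(x, y) \<in> set xs. Q x y)"

text \<open>A successful search has settled one of the pairs in its list of choices.  The auxiliary functions
  are called in the middle of examining one choice, hence the alternative \<open>Q p q\<close>.\<close>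

lemma search_sound_mutual:
  "search T m xs \<Longrightarrow> sound_table T \<Longrightarrow> inside xs \<Longrightarrow> good xs"
  "visit T m xs p q e e' \<Longrightarrow> sound_table T \<Longrightarrow> inside xs \<Longrightarrow> sound_entry p e \<Longrightarrow> sound_entry q e' \<Longrightarrow>
     Q p q \<or> good xs"
  "branch T m xs p q e e' b \<Longrightarrow> sound_table T \<Longrightarrow> inside xs \<Longrightarrow> sound_entry p e \<Longrightarrow> sound_entry q e' \<Longrightarrow>
     (b \<Longrightarrow> Q p q) \<Longrightarrow> Q p q \<or> good xs"
  "next_choice T m xs b \<Longrightarrow> sound_table T \<Longrightarrow> inside xs \<Longrightarrow> b \<or> good xs"
proof (induction T m xs and T m xs p q e e' and T m xs p q e e' b and T m xs b
    rule: search_visit_branch_next_choice.induct)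
  case (3 T m r a s b xs)
  have "(r, b) \<in> window n" "(s, a) \<in> window n" "(r, a) \<in> window n" "(s, b) \<in> window n"
    using 3(4) by (auto simp: window_def)
  then have "Q (r, b) (s, a) \<or> good xs"
    using 3 by (intro 3(1)) (auto simp: sound_table_def)
  then show ?case
    using swap[of r a s b] \<open>(r, a) \<in> window n\<close> \<open>(s, b) \<in> window n\<close> by (auto simp: good_def)
next
  case (4 T m xs p q e e')
  then show ?case using direct_sound[of e e' p q] by simp
next
  case (6 T m xs p q e e')
  have choices: "set (other_choices p q e e') \<subseteq> set (List.product (fst e) (fst e'))"
    unfolding other_choices_def by (rule set_remove1_subset)
  then have "inside (other_choices p q e e')" using choice_window[OF 6(6,7)] by blast
  moreover have "Q p q" if "good (other_choices p q e e')"
    using that choices choice_sound[OF 6(6,7)] unfolding good_def by blast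
  ultimately show ?case using 6 by auto
qed (auto simp: good_def)

lemma connected_sound:
  assumes T: "sound_table T" and e: "sound_entry p e" "sound_entry q e'" and "connected T e e'"
  shows "Q p q"
proof (cases "direct e e'")
  case True
  then show ?thesis using direct_sound e by blast
next
  case False
  then have "search T fuel (List.product (fst e) (fst e'))" using assms(4) by (simp add: connected_def)
  then show ?thesis using search_sound_mutual(1)[OF _ T choice_window[OF e]] choice_sound[OF e] unfolding good_def by blast
qed

definition sound_rules :: "(tag \<times> cell list) list \<Rightarrow> bool" where
  "sound_rules Rs \<longleftrightarrow> (\<forall>(k, qs) \<in> set Rs. set qs \<subseteq> window n \<and>
     (\<forall>p \<in> window n. (\<forall>q \<in> set qs. Q p q) \<longrightarrow> (\<forall>q \<in> Tag k \<inter> window n. Q p q)))"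

lemma sound_rules_Nil: "sound_rules []"
  by (simp add: sound_rules_def)

lemma connected_all_sound:
  assumes T: "sound_table T" and e: "sound_entry p e"
  shows "connected_all T e qs \<Longrightarrow> set qs \<subseteq> window n \<Longrightarrow> \<forall>q \<in> set qs. Q p q"
proof (induction qs)
  case (Cons q qs)
  then show ?case using Cons connected_sound[OF T e, of q "look T q"] T by (auto simp: sound_table_def)
qed simp

lemma learn_sound:
  assumes "b \<Longrightarrow> \<forall>q \<in> Tag k \<inter> window n. Q p q" "sound_entry p e"
  shows "sound_entry p (learn k b e)"
proof -
  obtain ps hs ks where "e = (ps, hs, ks)" by (cases e)
  then show ?thesis using assms by (cases b) simp_all
qed

lemma improve_sound:
  assumes T: "sound_table T"
  shows "sound_rules Rs \<Longrightarrow> sound_entry p e \<Longrightarrow> sound_entry p (improve T Rs e)"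
proof (induction Rs arbitrary: e)
  case (Cons rule Rs)
  obtain k qs where rule: "rule = (k, qs)" by (cases rule)
  have "sound_entry p (learn k (connected_all T e qs) e)"
  proof -
    have "\<forall>q \<in> Tag k \<inter> window n. Q p q" if "connected_all T e qs"
      using connected_all_sound[OF T Cons.prems(2) that] Cons.prems(1) sound_entry_window[OF Cons.prems(2)]
      unfolding rule sound_rules_def by auto
    then show ?thesis using learn_sound[OF _ Cons.prems(2), of "connected_all T e qs" k] by blast
  qed
  then show ?case using Cons by (simp add: rule sound_rules_def)
qed simp

definition shaped :: "'a list list \<Rightarrow> bool" where
  "shaped T \<longleftrightarrow> length T = n \<and> (\<forall>row \<in> set T. length row = 4)"

lemma look_shaped: "shaped T \<Longrightarrow> (r, c) \<in> window n \<Longrightarrow> look T (r, c) = T ! r ! c"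
  by (simp add: shaped_def window_def at_eq_nth)

lemma rounds_sound:
  "sound_rules Rs \<Longrightarrow> shaped T \<Longrightarrow> sound_table T \<Longrightarrow> shaped (rounds m Rs T) \<and> sound_table (rounds m Rs T)"
proof (induction m Rs T rule: rounds.induct)
  case (2 m Rs T)
  let ?T' = "map (map (improve T Rs)) T"
  have shaped: "shaped ?T'" using 2 by (auto simp: shaped_def)
  have "sound_entry (r, c) (look ?T' (r, c))" if "(r, c) \<in> window n" for r c
  proof -
    have "look ?T' (r, c) = improve T Rs (look T (r, c))"
      using look_shaped[OF shaped that] look_shaped[OF 2(3) that] 2(3) that
      by (simp add: shaped_def window_def)
    moreover have "sound_entry (r, c) (look T (r, c))" using 2(4) that unfolding sound_table_def by blast
    ultimately show ?thesis using improve_sound[OF 2(4,2)] by simp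
  qed
  then have "sound_table ?T'" by (auto simp: sound_table_def)
  then show ?case using 2 shaped by simp
qed simp

lemma sorted_wrt_total: "sorted_wrt P xs \<Longrightarrow> x \<in> set xs \<Longrightarrow> y \<in> set xs \<Longrightarrow> x = y \<or> P x y \<or> P y x"
  by (induction xs) auto

lemma all_connected_sound:
  assumes "all_connected T" "shaped T" "sound_table T" "p \<in> window n" "q \<in> window n"
  shows "Q p q"
proof -
  have "set (cells (length T)) = window n"
    using assms(2) by (auto simp: cells_def shaped_def window_def)
  then consider "p = q" | "connected_cells T p q" | "connected_cells T q p"
    using sorted_wrt_total[of "connected_cells T" _ p q] assms unfolding all_connected_def by metis
  then show ?thesis
  proof cases
    case 1
    then show ?thesis using refl assms(4) by simp
  next
    case 2
    then show ?thesis
      using connected_sound[OF assms(3), of p "look T p" q "look T q"] assms(3-5)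
      unfolding connected_cells_def sound_table_def by blast
  next
    case 3
    then show ?thesis
      using connected_sound[OF assms(3), of q "look T q" p "look T p"] assms(3-5) sym
      unfolding connected_cells_def sound_table_def by blast
  qed
qed

end

section \<open>Windows onto the configurations\<close>

text \<open>A pair \<open>(l, l')\<close> in \<open>X\<close> declares that cells labelled \<open>l'\<close> may replace those labelled \<open>l\<close>.\<close>

fun cells_with :: "(label \<times> label) list \<Rightarrow> label \<Rightarrow> (label \<times> cell) list \<Rightarrow> cell list" where
  "cells_with X l [] = []"
| "cells_with X l ((l', p) # ps) =
    (if l = l' \<or> (l, l') \<in> set X then p # cells_with X l ps else cells_with X l ps)"

fun family :: "label \<Rightarrow> tag list" where
  "family (A i) = [A_cells]"
| "family (S i) = [S_cells]"
| "family l = []"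

text \<open>A version of \<open>chain_label\<close> for symbolic labels, whose indices have no numerical meaning.\<close>

fun chain_symbol :: "label \<Rightarrow> bool" where
  "chain_symbol Dot = False"
| "chain_symbol (B j) = (j = 9)"
| "chain_symbol l = True"

text \<open>Every \<open>A j\<close> has cells in the columns 1 and 3, and every \<open>S j\<close> in the columns 1 and 2 (0, 2 and 0, 1 when
  counted from 0), although a window need not show both cells.\<close>

definition knows :: "tag list \<Rightarrow> tag list" where
  "knows hs = (if Column 0 \<in> set hs then [A_cells, S_cells] else
       (if Column 1 \<in> set hs then [S_cells] else []) @ (if Column 2 \<in> set hs then [A_cells] else []))"

fun entry_with :: "label \<Rightarrow> cell list \<Rightarrow> entry" where
  "entry_with l ps =
    (let hs = map (\<lambda>p. Column (snd p)) ps @ map (\<lambda>p. Row (fst p)) ps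
     in (ps, hs @ (if chain_symbol l then [Chain] else []) @ family l, knows hs))"

fun entry_for :: "(label \<times> label) list \<Rightarrow> (label \<times> cell) list \<Rightarrow> label \<times> cell \<Rightarrow> entry" where
  "entry_for X M (l, p) = entry_with l (if one_label l then [p] else cells_with X l M)"

definition labelled :: "label list list \<Rightarrow> (label \<times> cell) list list" where
  "labelled M = map (\<lambda>r. map (\<lambda>c. (M ! r ! c, r, c)) [0..<4]) [0..<length M]"

definition table :: "label list list \<Rightarrow> (label \<times> label) list \<Rightarrow> entry list list" where
  "table M X = map (map (entry_for X (concat (labelled M)))) (labelled M)"

text \<open>For \<open>t = 0\<close> the window shows the whole grid.\<close>

definition "seed_window = base_rows @ [[B 9, S 0, A 0, W]]"

text \<open>For \<open>t \<ge> 1\<close> the last three rows are the two rows of level \<open>i\<close> and the last row of the grid.  The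
  symbols \<open>A 0\<close>, \<open>A 1\<close>, \<open>A 2\<close>, \<open>A 3\<close> stand for \<open>A 0\<close>, \<open>A (i - 1)\<close>, \<open>A i\<close>, \<open>A t\<close>, and likewise for \<open>S\<close>.\<close>

definition "level_window = base_rows @ [[A 2, U 1, A 1, R 1], [S 2, S 1, V 1, R 1], [B 9, S 3, A 3, W]]"

text \<open>What holds for \<open>A i\<close> on all levels holds for \<open>A t\<close>, and what holds for \<open>A (i - 1)\<close> on all levels
  holds for \<open>A 0\<close>.\<close>

definition "level_instances = [(A 3, A 2), (A 0, A 1), (S 3, S 2), (S 0, S 1)]"

text \<open>The labels \<open>A j\<close> with \<open>0 \<le> j \<le> t\<close> are exhausted by the \<open>A i\<close> with \<open>1 \<le> i \<le> t\<close> together with \<open>A 0\<close>, and also by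
  the \<open>A (i - 1)\<close> together with \<open>A t\<close>.  The same holds for \<open>S\<close>.\<close>

definition "level_rules = [(A_cells,[(15,0),(1,0)]), (A_cells,[(15,2),(17,2)]), (S_cells,[(16,0),(2,0)]),(S_cells,[(16,1),(17,1)::cell])]"

lemma all_connected_seed: "all_connected (table seed_window [])"
  by code_simp

text \<open>Some pairs are only reachable after a fixed cell is known to be settled with the whole family \<open>A\<close> or \<open>S\<close>,
  and these facts in turn depend on each other.  After seven rounds all of them are available.\<close>

lemma all_connected_levels: "all_connected (rounds 7 level_rules (table level_window level_instances))"
  by code_simp

lemma certified_B: assumes "p \<in> grid 15 4" "base_label p = B j" shows "certified t (B j)"
proof -
  have "list_all (\<lambda>p. \<forall>j. base_label p = B j \<longrightarrow>
      j \<in> {1, 3, 5, 6, 7, 8, 9, 10, 11, 12, 13, 14, 15, 16, 17, 18, 19, 20, 21}) base_cells"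
    by (simp add: base_cells_def base_label_def base_rows_eval upt_rec)
  then have "j \<in> {1, 3, 5, 6, 7, 8, 9, 10, 11, 12, 13, 14, 15, 16, 17, 18, 19, 20, 21}"
    using assms unfolding list_all_iff set_base_cells by blast
  then show ?thesis
    using certified_line_pairs certified_complementary certified_17 certified_15 certified_18 certified_20
      certified_10 certified_5 certified_6 certified_7 certified_12 certified_9 certified_8 certified_3
    by auto
qed

lemma chain_label_if_symbol:
  assumes p: "p \<in> K_grid t" "chain_symbol (lab t p)"
  shows "chain_label t (lab t p)"
  using p(1)
proof (cases rule: K_grid_cases)
  case base
  from base show ?thesis by (cases rule: base_cases) (use base p in \<open>auto simp: lab_base\<close>)
next
  case (u k c)
  then show ?thesis using four_columns[of c] by auto
next
  case (v k c)
  then show ?thesis using four_columns[of c] by auto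
next
  case (w c)
  then show ?thesis using four_columns[of c] by auto
qed

lemma settledK_chain:
  "p \<in> K_grid t \<Longrightarrow> q \<in> K_grid t \<Longrightarrow> chain_symbol (lab t p) \<Longrightarrow> chain_symbol (lab t q) \<Longrightarrow> settledK t p q"
  using linked_chain[OF chain_label_if_symbol chain_label_if_symbol, of p t q] unfolding linked_def by blast

lemma certified_all:
  assumes p: "p \<in> K_grid t" "\<not> one_label (lab t p)"
  shows "certified t (lab t p)"
proof (cases "chain_symbol (lab t p)")
  case True
  then have "chain_label t (lab t p)" using chain_label_if_symbol p by simp
  then show ?thesis
    using p(2) by (cases "lab t p") (auto simp: certified_A certified_S certified_R certified_9)
next
  case False
  with p have "p \<in> grid 15 4 \<and> (\<exists>j. base_label p = B j)"
  proof (cases rule: K_grid_cases)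
    case base
    from base show ?thesis by (cases rule: base_cases) (use base p False in \<open>auto simp: lab_base\<close>)
  next
    case (u k c)
    then show ?thesis using four_columns[of c] False by auto
  next
    case (v k c)
    then show ?thesis using four_columns[of c] False by auto
  next
    case (w c)
    then show ?thesis using four_columns[of c] False by auto
  qed
  then obtain j where "p \<in> grid 15 4" "base_label p = B j" by blast
  then show ?thesis using certified_B[of p j t] lab_base[of p t] by simp
qed

lemma settledK_relabel:
  assumes "settledK t p q" "p \<in> K_grid t" "p' \<in> K_grid t" "q \<in> K_grid t" "lab t p' = lab t p" "\<not> one_label (lab t p)"
  shows "settledK t p' q"
  using assms certified_all[of p t] by (intro settledK_twin1[OF assms(1)]) (simp_all add: twin_def)

lemma settledK_A_column:
  assumes "p \<in> K_grid t" "q \<in> K_grid t" "lab t q = A j" "snd p \<in> {1, 3}"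
  shows "settledK t p q"
proof -
  have j: "j \<le> t" using chain_label_if_symbol[OF assms(2)] assms(3) by simp
  define a :: cell where "a = (if snd p = 1 then (if j = 0 then 2 else 14 + 2 * j, 1) else (16 + 2 * j, 3))"
  have a: "a \<in> K_grid t" "lab t a = A j" "snd a = snd p"
    using lab_A[OF j] assms(4) j by (auto simp: a_def in_K_grid)
  then have "settledK t a p" using assms(1) by (intro settledK_line) auto
  then have "settledK t q p" using a assms by (intro settledK_relabel[of t a p q]) auto
  then show ?thesis by (rule settled_sym)
qed

lemma settledK_S_column:
  assumes "p \<in> K_grid t" "q \<in> K_grid t" "lab t q = S j" "snd p \<in> {1, 2}"
  shows "settledK t p q"
proof -
  have j: "j \<le> t" using chain_label_if_symbol[OF assms(2)] assms(3) by simp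
  define a :: cell where "a = (if snd p = 1 then (if j = 0 then 3 else 15 + 2 * j, 1)
     else (if j = t then 16 + 2 * t else 17 + 2 * j, 2))"
  have a: "a \<in> K_grid t" "lab t a = S j" "snd a = snd p"
    using lab_S[OF j] assms(4) j by (auto simp: a_def in_K_grid)
  then have "settledK t a p" using assms(1) by (intro settledK_line) auto
  then have "settledK t q p" using a assms by (intro settledK_relabel[of t a p q]) auto
  then show ?thesis by (rule settled_sym)
qed

lemma set_cells_with: "p \<in> set (cells_with X l M) \<longleftrightarrow> (\<exists>l'. (l', p) \<in> set M \<and> (l = l' \<or> (l, l') \<in> set X))"
  by (induction X l M rule: cells_with.induct) auto

lemma set_labelled: "(l, r, c) \<in> set (concat (labelled M)) \<longleftrightarrow> (r, c) \<in> window (length M) \<and> l = M ! r ! c"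
  by (auto simp: labelled_def window_def image_iff)

text \<open>A matrix \<open>M\<close> of symbolic labels is placed in \<open>K t\<close> once for every parameter \<open>i\<close> in \<open>I\<close>; \<open>row i\<close> gives the
  actual rows and \<open>actual i\<close> the actual labels.  Rows with a label outside the tail do not move.\<close>

locale K_window =
  fixes t :: nat and M :: "label list list" and X :: "(label \<times> label) list"
    and I :: "nat set" and row :: "nat \<Rightarrow> nat \<Rightarrow> nat" and actual :: "nat \<Rightarrow> label \<Rightarrow> label"
  assumes row_in: "i \<in> I \<Longrightarrow> r < length M \<Longrightarrow> row i r \<in> {1..16 + 2 * t}"
    and lab_row: "i \<in> I \<Longrightarrow> (r, c) \<in> window (length M) \<Longrightarrow> lab t (row i r, c + 1) = actual i (M ! r ! c)"
    and actual_one: "one_label (actual i l) = one_label l"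
    and actual_chain: "chain_symbol (actual i l) = chain_symbol l"
    and actual_A: "\<exists>j. actual i (A k) = A j"
    and actual_S: "\<exists>j. actual i (S k) = S j"
    and fixed_rows: "i \<in> I \<Longrightarrow> i' \<in> I \<Longrightarrow> (r, c) \<in> window (length M) \<Longrightarrow> \<not> chain_symbol (M ! r ! c) \<Longrightarrow> row i r = row i' r"
    and X_instance: "(l, l') \<in> set X \<Longrightarrow> \<exists>i' \<in> I. \<forall>i \<in> I. actual i l = actual i' l'"
    and X_two: "(l, l') \<in> set X \<Longrightarrow> \<not> one_label l' \<and> chain_symbol l"
begin

fun place :: "nat \<Rightarrow> cell \<Rightarrow> cell" where "place i (r, c) = (row i r, c + 1)"

fun symbol :: "cell \<Rightarrow> label" where "symbol (r, c) = M ! r ! c"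

abbreviation D :: "cell set" where "D \<equiv> window (length M)"

definition Q :: "cell \<Rightarrow> cell \<Rightarrow> bool" where
  "Q p q \<longleftrightarrow> (\<forall>i \<in> I. settledK t (place i p) (place i q))"

fun Tag :: "tag \<Rightarrow> cell set" where
  "Tag (Row r) = {p. fst p = r}"
| "Tag (Column c) = {p. snd p = c}"
| "Tag A_cells = {p. \<exists>k. symbol p = A k}"
| "Tag S_cells = {p. \<exists>k. symbol p = S k}"
| "Tag Chain = {p. chain_symbol (symbol p)}"

lemma place_in: "i \<in> I \<Longrightarrow> p \<in> D \<Longrightarrow> place i p \<in> K_grid t"
  using row_in[of i "fst p"] by (cases p) (auto simp: window_def grid_iff)

lemma lab_place: "i \<in> I \<Longrightarrow> p \<in> D \<Longrightarrow> lab t (place i p) = actual i (symbol p)"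
  using lab_row by (cases p) simp

lemma Q_chain: "p \<in> D \<Longrightarrow> q \<in> D \<Longrightarrow> chain_symbol (symbol p) \<Longrightarrow> chain_symbol (symbol q) \<Longrightarrow> Q p q"
  unfolding Q_def using settledK_chain place_in lab_place actual_chain by simp

lemma fixed_place:
  assumes "i \<in> I" "i' \<in> I" "p \<in> D" "\<not> chain_symbol (symbol p)"
  shows "place i p = place i' p"
proof -
  obtain r c where p: "p = (r, c)" by (cases p)
  have "row i r = row i' r" using fixed_rows[OF assms(1,2), of r c] assms(3,4) by (simp add: p)
  then show ?thesis by (simp add: p)
qed

sublocale swap_relation "length M" Q Tag
proof
  show "Q p p" if "p \<in> D" for p
    unfolding Q_def using that by (intro ballI settledK_line place_in) auto
  show "Q q p" if "Q p q" for p q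
    using that settled_sym unfolding Q_def by blast
  show "Q (r, a) (s, b)" if D: "(r, a) \<in> D" "(s, b) \<in> D" and sw: "Q (r, b) (s, a)" for r a s b
    unfolding Q_def
  proof
    fix i assume i: "i \<in> I"
    show "settledK t (place i (r, a)) (place i (s, b))"
      using sw i place_in[OF i D(1)] place_in[OF i D(2)] unfolding Q_def place.simps by (blast intro: settledK_swap)
  qed
  show "Q p q" if "p \<in> D" "q \<in> D" "p \<in> Tag h" "q \<in> Tag h" for p q h
  proof (cases "chain_symbol (symbol p) \<and> chain_symbol (symbol q)")
    case True
    then show ?thesis using Q_chain that by blast
  next
    case False
    then have "fst p = fst q \<or> snd p = snd q" using that(3,4) by (cases h) auto
    then have "fst (place i p) = fst (place i q) \<or> snd (place i p) = snd (place i q)" for i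
      by (cases p; cases q) auto
    then show ?thesis unfolding Q_def using that(1,2) by (intro ballI settledK_line place_in)
  qed
qed

lemma forces_same:
  assumes "p \<in> D" "a \<in> D" "symbol a = symbol p" "\<not> one_label (symbol p)"
  shows "forces a p"
  unfolding forces_def
proof (intro conjI ballI impI)
  fix q assume q: "q \<in> D" "Q a q"
  show "Q p q"
    unfolding Q_def
  proof
    fix i assume i: "i \<in> I"
    have "settledK t (place i a) (place i q)" using q i by (simp add: Q_def)
    then show "settledK t (place i p) (place i q)"
      by (rule settledK_relabel) (use i q assms in \<open>simp_all add: place_in lab_place actual_one\<close>)
  qed
qed (rule assms)

text \<open>If \<open>q\<close> does not move with \<open>i\<close>, the fact about \<open>a\<close> at the parameter \<open>i'\<close> is the fact about \<open>p\<close> at every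
  parameter.  Otherwise \<open>p\<close> and \<open>q\<close> both have labels of the tail.\<close>

lemma forces_instance:
  assumes p: "p \<in> D" and a: "a \<in> D" and X: "(symbol p, symbol a) \<in> set X"
  shows "forces a p"
  unfolding forces_def
proof (intro conjI ballI impI)
  fix q assume q: "q \<in> D" and Q: "Q a q"
  show "Q p q"
  proof (cases "chain_symbol (symbol q)")
    case True
    then show ?thesis using Q_chain p q X_two[OF X] by simp
  next
    case False
    obtain i' where i': "i' \<in> I" "\<And>i. i \<in> I \<Longrightarrow> actual i (symbol p) = actual i' (symbol a)"
      using X_instance[OF X] by blast
    show ?thesis
      unfolding Q_def
    proof
      fix i assume i: "i \<in> I"
      have "settledK t (place i' a) (place i q)"
        using Q i' fixed_place[OF i i'(1) q False] unfolding Q_def by simp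
      then show "settledK t (place i p) (place i q)"
        by (rule settledK_relabel) (use i i' p q a X_two[OF X] in \<open>simp_all add: place_in lab_place actual_one\<close>)
    qed
  qed
qed (rule a)

lemma snd_place: "snd (place i p) = snd p + 1"
  by (cases p) simp

lemma Q_A_column:
  assumes "p \<in> D" "q \<in> D" "symbol q = A k" "snd p \<in> {0, 2}"
  shows "Q p q"
  unfolding Q_def
proof
  fix i assume i: "i \<in> I"
  obtain j where "actual i (A k) = A j" using actual_A by blast
  then have "lab t (place i q) = A j" using lab_place[OF i assms(2)] assms(3) by simp
  moreover have "snd (place i p) \<in> {1, 3}" using assms(4) by (auto simp: snd_place)
  ultimately show "settledK t (place i p) (place i q)" using place_in[OF i] assms(1,2) by (intro settledK_A_column)
qed

lemma Q_S_column:
  assumes "p \<in> D" "q \<in> D" "symbol q = S k" "snd p \<in> {0, 1}"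
  shows "Q p q"
  unfolding Q_def
proof
  fix i assume i: "i \<in> I"
  obtain j where "actual i (S k) = S j" using actual_S by blast
  then have "lab t (place i q) = S j" using lab_place[OF i assms(2)] assms(3) by simp
  moreover have "snd (place i p) \<in> {1, 2}" using assms(4) by (auto simp: snd_place)
  ultimately show "settledK t (place i p) (place i q)" using place_in[OF i] assms(1,2) by (intro settledK_S_column)
qed

lemma sound_entry_for:
  assumes p: "p \<in> D"
  shows "sound_entry p (entry_for X (concat (labelled M)) (symbol p, p))"
proof -
  define ps where "ps = (if one_label (symbol p) then [p] else cells_with X (symbol p) (concat (labelled M)))"
  define hs where "hs = map (\<lambda>p. Column (snd p)) ps @ map (\<lambda>p. Row (fst p)) ps"
  have ps: "forces a p" if a: "a \<in> set ps" for a
  proof (cases "one_label (symbol p)")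
    case True
    then show ?thesis using a p by (simp add: ps_def forces_def)
  next
    case False
    then have "a \<in> D \<and> (symbol p = symbol a \<or> (symbol p, symbol a) \<in> set X)"
      using a set_labelled[of _ "fst a" "snd a" M] by (cases a) (auto simp: ps_def set_cells_with simp del: set_concat)
    then show ?thesis using forces_same[OF p, of a] forces_instance[OF p, of a] False by auto
  qed
  have self: "forces p p" using p by (simp add: forces_def)
  have hs: "\<exists>a \<in> Tag h. forces a p" if h: "h \<in> set hs" for h
  proof -
    obtain a where "a \<in> set ps" "h = Column (snd a) \<or> h = Row (fst a)" using h by (auto simp: hs_def)
    then show ?thesis using ps by (intro bexI[of _ a]) auto
  qed
  have "Q p q" if k: "k \<in> set (knows hs)" and q: "q \<in> Tag k" "q \<in> D" for k q
  proof -
    consider c where "k = A_cells" "c \<in> {0, 2}" "Column c \<in> set hs"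
      | c where "k = S_cells" "c \<in> {0, 1}" "Column c \<in> set hs"
      using k by (auto simp: knows_def split: if_splits)
    then show ?thesis
    proof cases
      case 1
      then obtain a where "snd a = c" "forces a p" using hs by fastforce
      then show ?thesis using Q_A_column[of a q] q 1 unfolding forces_def by auto
    next
      case 2
      then obtain a where "snd a = c" "forces a p" using hs by fastforce
      then show ?thesis using Q_S_column[of a q] q 2 unfolding forces_def by auto
    qed
  qed
  moreover have "\<exists>a \<in> Tag h. forces a p" if "h \<in> set (family (symbol p))" for h
    using that self by (intro bexI[of _ p]) (cases "symbol p"; simp)+
  moreover have "\<exists>a \<in> Tag Chain. forces a p" if "chain_symbol (symbol p)"
    using that self by (intro bexI[of _ p]) simp_all
  ultimately show ?thesis
    using p ps hs by (auto simp: ps_def[symmetric] Let_def hs_def[symmetric])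
qed

lemma shaped_table: "shaped (table M X)"
  by (auto simp: shaped_def table_def labelled_def)

lemma sound_table_table: "sound_table (table M X)"
  unfolding sound_table_def
proof
  fix p assume p: "p \<in> D"
  obtain r c where rc: "p = (r, c)" by (cases p)
  have "look (table M X) p = entry_for X (concat (labelled M)) (symbol p, p)"
    using p look_shaped[OF shaped_table, of r c] unfolding rc
    by (simp add: table_def labelled_def window_def)
  then show "sound_entry p (look (table M X) p)" using sound_entry_for[OF p] by simp
qed

lemma Q_all:
  assumes "all_connected (rounds m Rs (table M X))" "sound_rules Rs" "p \<in> D" "q \<in> D"
  shows "Q p q"
  using all_connected_sound[OF assms(1) _ _ assms(3,4)] rounds_sound[OF assms(2) shaped_table sound_table_table]
  by blast

end

section \<open>All pairs of cells are settled\<close>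

lemma length_base_rows: "length base_rows = 15"
  by (simp add: base_rows_eval)

text \<open>Below row 15 all labels belong to the tail.\<close>

lemma all_settledI:
  assumes base: "\<And>p q. p \<in> grid 15 4 \<Longrightarrow> q \<in> K_grid t \<Longrightarrow> settledK t p q"
    and "p \<in> K_grid t" "q \<in> K_grid t"
  shows "settledK t p q"
proof -
  have tail: "chain_symbol (lab t p)" if "p \<in> K_grid t" "p \<notin> grid 15 4" for p
    using that(1)
  proof (cases rule: K_grid_cases)
    case (u k c)
    then show ?thesis using four_columns[of c] by auto
  next
    case (v k c)
    then show ?thesis using four_columns[of c] by auto
  next
    case (w c)
    then show ?thesis using four_columns[of c] by auto
  qed (use that in simp)
  then show ?thesis using base assms(2,3) settled_sym settledK_chain by metis
qed

lemma K_window_seed: "K_window 0 seed_window [] {0} (\<lambda>i. Suc) (\<lambda>i l. l)"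
proof
  fix i r c :: nat assume "(r, c) \<in> window (length seed_window)"
  then have "r < 16" "c < 4" by (auto simp: window_def seed_window_def length_base_rows)
  then show "lab 0 (Suc r, c + 1) = seed_window ! r ! c"
    by (cases "r = 15") (auto simp: seed_window_def lab_def label_at_def nth_append length_base_rows)
qed (auto simp: seed_window_def length_base_rows)

lemma all_settled_seed:
  assumes "p \<in> K_grid 0" "q \<in> K_grid 0"
  shows "settledK 0 p q"
proof -
  interpret K_window 0 seed_window "[]" "{0}" "\<lambda>i. Suc" "\<lambda>i l. l" by (rule K_window_seed)
  have linked_0: "all_connected (rounds 0 [] (table seed_window []))" using all_connected_seed by simp
  have "length seed_window = 16" by (simp add: seed_window_def length_base_rows)
  then have "(fst p - 1, snd p - 1) \<in> D" "(fst q - 1, snd q - 1) \<in> D"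
    using assms by (auto simp: window_def grid_def)
  then have "Q (fst p - 1, snd p - 1) (fst q - 1, snd q - 1)"
    by (rule Q_all[OF linked_0 sound_rules_Nil])
  then have "settledK 0 (place 0 (fst p - 1, snd p - 1)) (place 0 (fst q - 1, snd q - 1))"
    unfolding Q_def by blast
  moreover have "place 0 (fst p - 1, snd p - 1) = p" if "p \<in> K_grid 0" for p
    using that by (cases p) (auto simp: grid_def)
  ultimately show ?thesis using assms by simp
qed

fun level_row :: "nat \<Rightarrow> nat \<Rightarrow> nat \<Rightarrow> nat" where
  "level_row t i r = (if r < 15 then r + 1 else if r = 15 then 14 + 2 * i else if r = 16 then 15 + 2 * i else 16 + 2 * t)"

fun level_label :: "nat \<Rightarrow> nat \<Rightarrow> label \<Rightarrow> label" where
  "level_label t i (A k) = A ([0, i - 1, i, t] ! k)"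
| "level_label t i (S k) = S ([0, i - 1, i, t] ! k)"
| "level_label t i (U k) = U i"
| "level_label t i (V k) = V i"
| "level_label t i (R k) = R i"
| "level_label t i l = l"

lemma level_label_base: "p \<in> grid 15 4 \<Longrightarrow> level_label t i (base_label p) = base_label p"
  by (elim base_cases) simp_all

lemma base_nth: "r < 15 \<Longrightarrow> c < 4 \<Longrightarrow> base_rows ! r ! c = base_label (r + 1, c + 1)"
  by (simp add: base_label_def)

lemma symbol_rows:
  assumes "r < 18"
  obtains "r < 15" "level_window ! r = base_rows ! r" | "r = 15" "level_window ! r = [A 2, U 1, A 1, R 1]"
    | "r = 16" "level_window ! r = [S 2, S 1, V 1, R 1]" | "r = 17" "level_window ! r = [B 9, S 3, A 3, W]"
proof -
  consider "r < 15" | "r = 15" | "r = 16" | "r = 17" using assms by linarith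
  then show thesis by cases (use that in \<open>simp_all add: level_window_def nth_append length_base_rows\<close>)
qed

lemma length_level_window: "length level_window = 18"
  by (simp add: level_window_def length_base_rows)

lemma K_window_level:
  assumes "1 \<le> t"
  shows "K_window t level_window level_instances {1..t} (level_row t) (level_label t)"
proof
  fix i r c :: nat assume i: "i \<in> {1..t}" and "(r, c) \<in> window (length level_window)"
  then have r: "r < 18" and c: "c < 4" by (auto simp: window_def length_level_window)
  then have c4: "c = 0 \<or> c = 1 \<or> c = 2 \<or> c = 3" by linarith
  show "lab t (level_row t i r, c + 1) = level_label t i (level_window ! r ! c)"
    using r
  proof (cases rule: symbol_rows)
    case 1
    then have "(r + 1, c + 1) \<in> grid 15 4" using c by (simp add: grid_def)
    then show ?thesis using 1 c lab_base[of "(r + 1, c + 1)" t] level_label_base[of "(r + 1, c + 1)" t i] base_nth[of r c]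
      by simp
  qed (use c4 i in \<open>auto simp: lab_u lab_v lab_w\<close>)
  show "level_row t i r = level_row t i' r" if "\<not> chain_symbol (level_window ! r ! c)" for i'
    using r by (cases rule: symbol_rows) (use that c4 in auto)
next
  fix l l' assume "(l, l') \<in> set level_instances"
  then show "\<not> one_label l' \<and> chain_symbol l" by (auto simp: level_instances_def)
  show "\<exists>i'\<in>{1..t}. \<forall>i\<in>{1..t}. level_label t i l = level_label t i' l'"
    using \<open>(l, l') \<in> set level_instances\<close> assms
    by (intro bexI[of _ "if l = A 3 \<or> l = S 3 then t else 1"]) (auto simp: level_instances_def)
next
  show "one_label (level_label t i l) = one_label l" "chain_symbol (level_label t i l) = chain_symbol l" for i l
    by (cases l; simp)+
qed (auto simp: length_level_window)

context K_window
begin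

text \<open>If \<open>p\<close> does not move with \<open>i\<close>, a fact about \<open>p\<close> at one parameter can be used at all others, so each
  actual label of \<open>q\<close> may be matched by a different cell \<open>a\<close> at a different parameter \<open>i'\<close>.\<close>

lemma lift_family:
  assumes p: "p \<in> D" "i0 \<in> I" and q: "q \<in> D" "chain_symbol (symbol q)" "\<not> one_label (symbol q)"
    and inst: "\<And>i. i \<in> I \<Longrightarrow> \<exists>i' \<in> I. \<exists>a \<in> D. Q p a \<and> actual i' (symbol a) = actual i (symbol q)"
  shows "Q p q"
proof (cases "chain_symbol (symbol p)")
  case True
  then show ?thesis using Q_chain p q by blast
next
  case False
  show ?thesis
    unfolding Q_def
  proof
    fix i assume i: "i \<in> I"
    obtain i' a where a: "i' \<in> I" "a \<in> D" "Q p a" "actual i' (symbol a) = actual i (symbol q)"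
      using inst[OF i] by blast
    then have "settledK t (place i' a) (place i p)"
      using fixed_place[OF i a(1) p(1) False] settled_sym unfolding Q_def by metis
    then have "settledK t (place i q) (place i p)"
      by (rule settledK_relabel) (use i a p q in \<open>simp_all add: place_in lab_place actual_one\<close>)
    then show "settledK t (place i p) (place i q)" by (rule settled_sym)
  qed
qed

end

lemma all_settled_levels:
  assumes t: "1 \<le> t" and pq: "p \<in> K_grid t" "q \<in> K_grid t"
  shows "settledK t p q"
proof -
  interpret K_window t level_window level_instances "{1..t}" "level_row t" "level_label t" by (rule K_window_level[OF t])
  have window_rows: "level_window ! 15 = [A 2, U 1, A 1, R 1]" "level_window ! 16 = [S 2, S 1, V 1, R 1]"
    "level_window ! 17 = [B 9, S 3, A 3, W]" "level_window ! 1 = base_rows ! 1" "level_window ! 2 = base_rows ! 2"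
    by (simp_all add: level_window_def nth_append length_base_rows)
  have index_A: "\<exists>j \<le> t. level_label t i (symbol q) = A j" if "i \<in> {1..t}" "q \<in> D" "symbol q = A k" for i q k
    using chain_label_if_symbol[OF place_in[OF that(1,2)]] lab_place[OF that(1,2)] that(3) by simp
  have index_S: "\<exists>j \<le> t. level_label t i (symbol q) = S j" if "i \<in> {1..t}" "q \<in> D" "symbol q = S k" for i q k
    using chain_label_if_symbol[OF place_in[OF that(1,2)]] lab_place[OF that(1,2)] that(3) by simp
  have D: "(15, 0) \<in> D" "(1, 0) \<in> D" "(15, 2) \<in> D" "(17, 2) \<in> D" "(16, 0) \<in> D" "(2, 0) \<in> D" "(16, 1) \<in> D" "(17, 1) \<in> D"
    by (simp_all add: window_def length_level_window)
  have A: "Q p q" if "p \<in> D" "q \<in> D" "symbol q = A k"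
    "\<And>j. j \<le> t \<Longrightarrow> \<exists>i' \<in> {1..t}. \<exists>a \<in> D. Q p a \<and> level_label t i' (symbol a) = A j" for p q k
  proof (rule lift_family[OF that(1) _ that(2)])
    show "t \<in> {1..t}" using t by simp
    fix i assume "i \<in> {1..t}"
    from index_A[OF this that(2,3)] obtain j where "j \<le> t" "level_label t i (symbol q) = A j" by blast
    then show "\<exists>i' \<in> {1..t}. \<exists>a \<in> D. Q p a \<and> level_label t i' (symbol a) = level_label t i (symbol q)"
      using that(4)[of j] by simp
  qed (use that(3) in simp_all)
  have S: "Q p q" if "p \<in> D" "q \<in> D" "symbol q = S k"
    "\<And>j. j \<le> t \<Longrightarrow> \<exists>i' \<in> {1..t}. \<exists>a \<in> D. Q p a \<and> level_label t i' (symbol a) = S j" for p q k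
  proof (rule lift_family[OF that(1) _ that(2)])
    show "t \<in> {1..t}" using t by simp
    fix i assume "i \<in> {1..t}"
    from index_S[OF this that(2,3)] obtain j where "j \<le> t" "level_label t i (symbol q) = S j" by blast
    then show "\<exists>i' \<in> {1..t}. \<exists>a \<in> D. Q p a \<and> level_label t i' (symbol a) = level_label t i (symbol q)"
      using that(4)[of j] by simp
  qed (use that(3) in simp_all)
  (* Row 15 shows A j in column 0 at the parameter j, and in column 2 at the parameter j + 1; row 16
     likewise shows S j in the columns 0 and 1.  A 0 and S 0 are in the rows 1 and 2, A t and S t in row 17, at every parameter. *)
  have "Q p q" if "p \<in> D" "q \<in> D" "symbol q = A k" "Q p (15, 0)" "Q p (1, 0)" for p q k
  proof (rule A[OF that(1-3)])
    fix j assume "j \<le> t"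
    then show "\<exists>i' \<in> {1..t}. \<exists>a \<in> D. Q p a \<and> level_label t i' (symbol a) = A j"
      using that t D window_rows by (intro bexI[of _ "if j = 0 then 1 else j"] bexI[of _ "(if j = 0 then 1 else 15, 0)"])
        (auto simp: base_rows_eval)
  qed
  moreover have "Q p q" if "p \<in> D" "q \<in> D" "symbol q = A k" "Q p (15, 2)" "Q p (17, 2)" for p q k
  proof (rule A[OF that(1-3)])
    fix j assume "j \<le> t"
    then show "\<exists>i' \<in> {1..t}. \<exists>a \<in> D. Q p a \<and> level_label t i' (symbol a) = A j"
      using that t D window_rows by (intro bexI[of _ "if j = t then 1 else j + 1"] bexI[of _ "(if j = t then 17 else 15, 2)"])
        auto
  qed
  moreover have "Q p q" if "p \<in> D" "q \<in> D" "symbol q = S k" "Q p (16, 0)" "Q p (2, 0)" for p q k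
  proof (rule S[OF that(1-3)])
    fix j assume "j \<le> t"
    then show "\<exists>i' \<in> {1..t}. \<exists>a \<in> D. Q p a \<and> level_label t i' (symbol a) = S j"
      using that t D window_rows by (intro bexI[of _ "if j = 0 then 1 else j"] bexI[of _ "(if j = 0 then 2 else 16, 0)"])
        (auto simp: base_rows_eval)
  qed
  moreover have "Q p q" if "p \<in> D" "q \<in> D" "symbol q = S k" "Q p (16, 1)" "Q p (17, 1)" for p q k
  proof (rule S[OF that(1-3)])
    fix j assume "j \<le> t"
    then show "\<exists>i' \<in> {1..t}. \<exists>a \<in> D. Q p a \<and> level_label t i' (symbol a) = S j"
      using that t D window_rows by (intro bexI[of _ "if j = t then 1 else j + 1"] bexI[of _ "(if j = t then 17 else 16, 1)"])
        auto
  qed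
  ultimately have "sound_rules level_rules"
    unfolding sound_rules_def level_rules_def using D by auto
  show ?thesis
  proof (rule all_settledI[OF _ pq])
    fix p q assume p: "p \<in> grid 15 4" and q: "q \<in> K_grid t"
    have "\<exists>i \<in> {1..t}. \<exists>q' \<in> D. place i q' = q"
      using q
    proof (cases rule: K_grid_cases)
      case base
      then show ?thesis using t by (intro bexI[of _ 1] bexI[of _ "(fst q - 1, snd q - 1)"]) (auto simp: window_def length_level_window grid_def)
    next
      case (u i c)
      then show ?thesis by (intro bexI[of _ i] bexI[of _ "(15, c - 1)"]) (auto simp: window_def length_level_window)
    next
      case (v i c)
      then show ?thesis by (intro bexI[of _ i] bexI[of _ "(16, c - 1)"]) (auto simp: window_def length_level_window)
    next
      case (w c)
      then show ?thesis using t by (intro bexI[of _ 1] bexI[of _ "(17, c - 1)"]) (auto simp: window_def length_level_window)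
    qed
    then obtain i q' where i: "i \<in> {1..t}" "q' \<in> D" "place i q' = q" by blast
    have "(fst p - 1, snd p - 1) \<in> D" "place i (fst p - 1, snd p - 1) = p"
      using p by (auto simp: window_def length_level_window grid_def)
    then show "settledK t p q"
      using Q_all[OF all_connected_levels \<open>sound_rules level_rules\<close> _ i(2)] i unfolding Q_def by metis
  qed
qed

theorem RW3_plus_K: "RW3_plus (K t)"
proof (rule RW3_plus_if_settled[OF aug_config_K simple_K])
  fix p q assume "p \<in> occupied (K t)" "q \<in> occupied (K t)"
  then show "settled (K t) p q"
    using all_settled_seed all_settled_levels[of t p q] by (cases "t = 0") (simp_all add: occupied_K)
qed

theorem proposition4p9:
  shows "(\<forall>t::nat.
           aug_config (16 + 2 * t) 4 (K t) \<and> simple_config (K t) \<and> RW3_plus (K t)) \<and>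
         (\<forall>t::nat. z_RL (16 + 2 * t) 4 = 43 + 5 * t)"
proof (intro conjI allI)
  fix t
  have "zarankiewicz (16 + 2 * t) 4 = 22 + 2 * t"
    using zarankiewicz_four_columns[of "one_edges (K t)" "16 + 2 * t"] C4_free_K card_one_edges_K[of t]
      aug_config_K[of t] by (simp add: aug_config_def)
  then have "z_RL (16 + 2 * t) 4 = num_edges (K t)"
    by (intro z_RL_eqI aug_config_K simple_K C4_free_K RW3_plus_K) (simp_all add: card_one_edges_K occupied_K)
  then show "z_RL (16 + 2 * t) 4 = 43 + 5 * t"
    using simple_config_count[OF aug_config_K simple_K, of t] card_one_edges_K[of t]
    by (simp add: num_edges_def occupied_K card_grid)
qed (rule aug_config_K simple_K RW3_plus_K)+

end
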